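(* For every positive integer $t$ there exists a finite simple graph $G$ such that $\bar\theta(G)=2$ and $\mathrm{bt}(G)\ge t$, where $\bar\theta(G)$ denotes the geometric thickness of $G$ and $\mathrm{bt}(G)$ denotes the book thickness of $G$.
   Context: All graphs are finite and simple. A straight-line drawing of a graph places the vertices at distinct points of the plane $\mathbb{R}^2$ and draws each edge as the straight line segment between the points representing its endpoints (with the usual convention that an edge passes through no vertex other than its own endpoints). Two edges cross if their segments share a point that is not a common endpoint of the two edges. The geometric thickness $\bar\theta(G)$ of a graph $G$ is the minimum number of layers in a straight-line drawing of $G$ in the plane in which each edge is assigned to a single layer and no two edges in the same layer cross. (Edges in different layers may cross; the vertex positions are the same for all layers.) The book thickness $\mathrm{bt}(G)$ of a graph $G$ is the minimum number of layers in a straight-line drawing of $G$ in the plane in which each edge is assigned to a single layer and no two edges in the same layer cross, with the further restriction that the vertices of $G$ are placed in convex position (i.e. they are the vertices of a strictly convex polygon). *)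

theory Defs
  imports "HOL-Analysis.Analysis"
begin

definition finite_simple_graph :: "'a set \<Rightarrow> 'a set set \<Rightarrow> bool" where
  "finite_simple_graph V E \<longleftrightarrow> finite V \<and> (\<forall>e\<in>E. e \<subseteq> V \<and> card e = 2)"

(* For e = {u, v} this is closed_segment (p u) (p v), by segment_convex_hull. *)
definition edge_segment :: "('a \<Rightarrow> real^2) \<Rightarrow> 'a set \<Rightarrow> (real^2) set" where
  "edge_segment p e = convex hull (p ` e)"

definition straight_line_drawing ::
    "'a set \<Rightarrow> 'a set set \<Rightarrow> ('a \<Rightarrow> real^2) \<Rightarrow> bool" where
  "straight_line_drawing V E p \<longleftrightarrow>
     inj_on p V \<and> (\<forall>e\<in>E. \<forall>w\<in>V. p w \<in> edge_segment p e \<longrightarrow> w \<in> e)"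

definition edges_cross :: "('a \<Rightarrow> real^2) \<Rightarrow> 'a set \<Rightarrow> 'a set \<Rightarrow> bool" where
  "edges_cross p e f \<longleftrightarrow>
     (\<exists>x \<in> edge_segment p e \<inter> edge_segment p f. x \<notin> p ` (e \<inter> f))"

definition noncrossing_layering ::
    "'a set set \<Rightarrow> ('a \<Rightarrow> real^2) \<Rightarrow> nat \<Rightarrow> ('a set \<Rightarrow> nat) \<Rightarrow> bool" where
  "noncrossing_layering E p k layer \<longleftrightarrow>
     (\<forall>e\<in>E. layer e < k) \<and>
     (\<forall>e\<in>E. \<forall>f\<in>E. e \<noteq> f \<and> layer e = layer f \<longrightarrow> \<not> edges_cross p e f)"

(* The points of S are the vertices of a strictly convex polygon; sets of at most
   two points (degenerate polygons) are in convex position as well. *)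
definition convex_position :: "(real^2) set \<Rightarrow> bool" where
  "convex_position S \<longleftrightarrow> (\<forall>x\<in>S. x extreme_point_of (convex hull S))"

(* For finite simple graphs both minima range over nonempty sets: place the vertices
   in convex position and give every edge a layer of its own.  Layers may be empty;
   this does not affect the minimum, which is 0 for an edgeless graph. *)
definition geometric_thickness :: "'a set \<Rightarrow> 'a set set \<Rightarrow> nat" where
  "geometric_thickness V E =
     (LEAST k. \<exists>p layer. straight_line_drawing V E p \<and> noncrossing_layering E p k layer)"

definition book_thickness :: "'a set \<Rightarrow> 'a set set \<Rightarrow> nat" where
  "book_thickness V E =
     (LEAST k. \<exists>p layer. straight_line_drawing V E p \<and> convex_position (p ` V) \<and>
        noncrossing_layering E p k layer)"

end

(*
  The graph is the disjoint union of K_5 and the complete graph on N + 1 vertices with every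
  edge subdivided once.

  Geometric thickness 2: place the i-th original vertex near (i, i) and the subdivision vertex
  of the edge ij (i < j) near (i, j). The edges from i to (i, j) form nearly vertical stars, the
  edges from (i, j) to j nearly horizontal ones, so two layers suffice. One layer is impossible
  because a straight-line drawing of K_5 has a crossing.

  Book thickness: in a drawing in convex position, order the vertices by slope as seen from one
  of them. Colour each pair of original vertices by the layers of its two edges and by the
  position of its subdivision vertex (before, between or after the pair). By Ramsey's theorem, for
  N large six original vertices are homogeneous, and each of the three positions then forces two
  edges of the same layer to interleave, hence to cross.
*)

theory Submission
  imports Defs "HOL-Library.Ramsey"
begin

section \<open>Subdivided cliques along a spine\<close>

text \<open>Convex position supplies only a cyclic order. Viewing the points from one original
  vertex cuts the cycle into a spine but uses up that vertex, hence N + 1 clique vertices for a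
  Ramsey number N. From then on the geometry enters through one implication: strictly interleaved
  endpoints on the spine give crossing segments.

  The obstacle is that a subdivision vertex may sit anywhere on the spine, so interleaved pairs of
  original vertices need not yield interleaved edges. Call the edge from a subdivision vertex to the
  smaller (larger) end of its pair the lower (upper) half. Once the position relative to the own
  pair is fixed, it suffices to compare lower halves with lower halves and upper with upper, so the
  two halves may use different layers. The number six is what the three pairwise interleaved pairs
  03, 14, 25 occupy when the subdivision vertices lie between.

  K_5 is added so that the lower bound 2 holds whatever N is and follows from the signs of
  orientations of five points, without any argument on nonplanarity of subdivisions.\<close>

lemma ramsey_pairs:
  fixes C :: "'c set" and q :: nat
  assumes "finite C"
  shows "\<exists>N :: nat. \<forall>f. (\<forall>i j. i < j \<and> j < N \<longrightarrow> f i j \<in> C) \<longrightarrow>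
    (\<exists>x c. strict_mono_on {..<q} x \<and> x ` {..<q} \<subseteq> {..<N} \<and>
      (\<forall>i j. i < j \<and> j < q \<longrightarrow> f (x i) (x j) = c))"
proof -
  \<comment> \<open>\<open>partn_lst\<close> colours two-element sets by numbers: \<open>b\<close>
    numbers the colours, and \<open>Min\<close> and \<open>Max\<close> recover the ordered pair from
    the set.\<close>
  obtain b where b: "bij_betw b C {..<card C}"
    using ex_bij_betw_finite_nat[OF assms] by (auto simp: atLeast0LessThan)
  obtain N where N: "partn_lst {..<N::nat} (replicate (card C) q) 2"
    using ramsey_full by blast
  have "\<exists>x c. strict_mono_on {..<q} x \<and> x ` {..<q} \<subseteq> {..<N} \<and>
      (\<forall>i j. i < j \<and> j < q \<longrightarrow> f (x i) (x j) = c)"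
    if f: "\<forall>i j. i < j \<and> j < N \<longrightarrow> f i j \<in> C" for f
  proof -
    have inC: "f (Min e) (Max e) \<in> C" if e: "e \<in> [{..<N}]\<^bsup>2\<^esup>" for e
    proof -
      obtain x y where "e = {x, y}" "x < y" "y < N"
        using e unfolding ordered_nsets_2_eq by auto
      then show ?thesis using f by (simp add: min_def max_def)
    qed
    then have "(\<lambda>e. b (f (Min e) (Max e))) \<in> [{..<N}]\<^bsup>2\<^esup> \<rightarrow> {..<card C}"
      using b by (auto simp: bij_betw_def)
    then obtain c H where c: "c < card C" and H: "H \<in> [{..<N}]\<^bsup>q\<^esup>"
      and hom: "(\<lambda>e. b (f (Min e) (Max e))) ` [H]\<^bsup>2\<^esup> \<subseteq> {c}"
      by (rule partn_lstE[OF N]) auto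
    have "finite H" "card H = q" "H \<subseteq> {..<N}"
      using H by (auto simp: nsets_def)
    then obtain x where x: "bij_betw x {..<q} H" "strict_mono_on {..<q} x"
      by (metis ex_bij_betw_strict_mono_card)
    have "f (x i) (x j) = inv_into C b c" if "i < j" "j < q" for i j
    proof -
      have lt: "x i < x j" and mem: "x i \<in> H" "x j \<in> H"
        using x that by (auto simp: strict_mono_on_def bij_betw_def)
      then have "b (f (Min {x i, x j}) (Max {x i, x j})) = c"
        using hom by (intro singletonD[OF subsetD, OF hom] imageI) auto
      then have "b (f (x i) (x j)) = c"
        using lt by (simp add: min_def max_def)
      moreover have "f (x i) (x j) \<in> C"
        using f lt mem \<open>H \<subseteq> {..<N}\<close> by auto
      ultimately show ?thesis
        using b by (auto simp: bij_betw_def)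
    qed
    then show ?thesis
      using x \<open>H \<subseteq> {..<N}\<close> by (metis bij_betw_imp_surj_on)
  qed
  then show ?thesis
    by blast
qed

text \<open>The pair that starts first is named first, so the relation is not symmetric; within each
  pair the endpoints come in either order. The conditions below quantify over all ordered pairs of
  edges, so nothing is lost.\<close>

definition interleave :: "real \<Rightarrow> real \<Rightarrow> real \<Rightarrow> real \<Rightarrow> bool" where
  "interleave a b c d \<longleftrightarrow> min a b < min c d \<and> min c d < max a b \<and> max a b < max c d"

lemma interleaveI:
  assumes "a < c" "c < b" "b < d"
  shows "interleave a b c d" "interleave b a c d" "interleave a b d c" "interleave b a d c"
  using assms unfolding interleave_def by (simp_all add: min_def max_def)

text \<open>Here \<open>s i\<close> is the place of the i-th vertex of a complete graph along the spine and \<open>m i j\<close> the place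
  of the subdivision vertex between the i-th and the j-th; it is only relevant for \<open>i < j\<close>.\<close>

definition noninterleaved_subdivision ::
    "nat \<Rightarrow> (nat \<Rightarrow> real) \<Rightarrow> (nat \<Rightarrow> nat \<Rightarrow> real) \<Rightarrow> bool" where
  "noninterleaved_subdivision n s m \<longleftrightarrow>
     (\<forall>i j. i < j \<and> j < n \<longrightarrow> s i < s j) \<and>
     (\<forall>i j k l. i < j \<and> j < n \<and> k < l \<and> l < n \<and> m i j = m k l \<longrightarrow> i = k \<and> j = l) \<and>
     (\<forall>i j k. i < j \<and> j < n \<and> k < n \<longrightarrow> m i j \<noteq> s k) \<and>
     (\<forall>i j k l. i < j \<and> j < n \<and> k < l \<and> l < n \<longrightarrow>
        \<not> interleave (s i) (m i j) (s k) (m k l) \<and> \<not> interleave (m i j) (s j) (m k l) (s l))"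

lemma
  assumes "noninterleaved_subdivision n s m"
  shows noninterleaved_subdivision_mono: "i < j \<Longrightarrow> j < n \<Longrightarrow> s i < s j"
    and noninterleaved_subdivision_inj:
      "i < j \<Longrightarrow> j < n \<Longrightarrow> k < l \<Longrightarrow> l < n \<Longrightarrow> m i j = m k l \<Longrightarrow> i = k \<and> j = l"
    and noninterleaved_subdivision_neq: "i < j \<Longrightarrow> j < n \<Longrightarrow> k < n \<Longrightarrow> m i j \<noteq> s k"
    and noninterleaved_subdivision_left: "i < j \<Longrightarrow> j < n \<Longrightarrow> k < l \<Longrightarrow> l < n \<Longrightarrow>
      \<not> interleave (s i) (m i j) (s k) (m k l)"
    and noninterleaved_subdivision_right: "i < j \<Longrightarrow> j < n \<Longrightarrow> k < l \<Longrightarrow> l < n \<Longrightarrow>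
      \<not> interleave (m i j) (s j) (m k l) (s l)"
proof -
  note D = assms[unfolded noninterleaved_subdivision_def]
  show "i < j \<Longrightarrow> j < n \<Longrightarrow> s i < s j"
    using D[THEN conjunct1] by blast
  show "i < j \<Longrightarrow> j < n \<Longrightarrow> k < l \<Longrightarrow> l < n \<Longrightarrow> m i j = m k l \<Longrightarrow> i = k \<and> j = l"
    using D[THEN conjunct2, THEN conjunct1] by blast
  show "i < j \<Longrightarrow> j < n \<Longrightarrow> k < n \<Longrightarrow> m i j \<noteq> s k"
    using D[THEN conjunct2, THEN conjunct2, THEN conjunct1] by blast
  note sep = D[THEN conjunct2, THEN conjunct2, THEN conjunct2, rule_format, OF conjI, OF _ conjI, OF _ _ conjI]
  show "i < j \<Longrightarrow> j < n \<Longrightarrow> k < l \<Longrightarrow> l < n \<Longrightarrow> \<not> interleave (s i) (m i j) (s k) (m k l)"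
    by (rule sep[THEN conjunct1])
  show "i < j \<Longrightarrow> j < n \<Longrightarrow> k < l \<Longrightarrow> l < n \<Longrightarrow> \<not> interleave (m i j) (s j) (m k l) (s l)"
    by (rule sep[THEN conjunct2])
qed

text \<open>Upper halves must be nested when both subdivision vertices precede both upper ends, so a
  later upper end forces an earlier subdivision vertex: \<open>m 1 5 < m 2 4 < m 1 3\<close>. Hence
  \<open>m 2 4\<close> precedes \<open>s 1\<close>, and the lower halves of the pairs 15 and 24
  interleave.\<close>

lemma not_all_before:
  assumes D: "noninterleaved_subdivision 6 s m"
    and before: "\<And>i j. i < j \<Longrightarrow> j < 6 \<Longrightarrow> m i j < s i"
  shows False
proof -
  note left = noninterleaved_subdivision_left[OF D] and right = noninterleaved_subdivision_right[OF D]
  have s: "s 1 < s 2" "s 2 < s 3" "s 3 < s 4" "s 4 < s 5"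
    by (rule noninterleaved_subdivision_mono[OF D]; simp)+
  have m: "m 2 4 < s 2" "m 1 3 < s 1" "m 1 5 < s 1"
    by (rule before; simp)+
  have neq: "m 1 3 \<noteq> m 2 4" "m 1 5 \<noteq> m 2 4" "m 2 4 \<noteq> s 1"
    using noninterleaved_subdivision_inj[OF D, of 1 3 2 4]
      noninterleaved_subdivision_inj[OF D, of 1 5 2 4]
      noninterleaved_subdivision_neq[OF D, of 2 4 1] by auto
  have "\<not> m 1 3 < m 2 4"
  proof
    assume *: "m 1 3 < m 2 4"
    have "interleave (m 1 3) (s 3) (m 2 4) (s 4)"
      using * m s by (intro interleaveI) auto
    then show False
      using right[of 1 3 2 4] by simp
  qed
  then have "m 2 4 < s 1"
    using m neq by auto
  moreover have "\<not> m 2 4 < m 1 5"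
  proof
    assume *: "m 2 4 < m 1 5"
    have "interleave (m 2 4) (s 4) (m 1 5) (s 5)"
      using * m s by (intro interleaveI) auto
    then show False
      using right[of 2 4 1 5] by simp
  qed
  ultimately have "interleave (s 1) (m 1 5) (s 2) (m 2 4)"
    using m s neq by (intro interleaveI) auto
  then show False
    using left[of 1 5 2 4] by simp
qed

text \<open>Reflecting the spine at 0 and reversing the indices exchanges lower and upper halves;
  this reduces the position after the pair to the position before it.\<close>

lemma noninterleaved_subdivision_mirror:
  assumes "noninterleaved_subdivision n s m"
  shows "noninterleaved_subdivision n (\<lambda>i. - s (n - 1 - i)) (\<lambda>i j. - m (n - 1 - j) (n - 1 - i))"
proof -
  \<comment> \<open>Reflection also changes which pair starts first, so the two pairs trade
    places.\<close>
  have flip: "interleave (- a) (- b) (- c) (- d) \<longleftrightarrow> interleave c d a b" for a b c d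
    unfolding interleave_def min_def max_def by auto
  have comm: "interleave a b c d \<longleftrightarrow> interleave b a d c" for a b c d
    unfolding interleave_def by (simp add: min.commute max.commute)
  show ?thesis
    unfolding noninterleaved_subdivision_def
  proof (intro conjI allI impI; (elim conjE)?)
    fix i j assume "i < j" "j < n"
    then show "- s (n - 1 - i) < - s (n - 1 - j)"
      using noninterleaved_subdivision_mono[OF assms, of "n - 1 - j" "n - 1 - i"] by simp
  next
    fix i j k l
    assume ij: "i < j" "j < n" "k < l" "l < n"
    show "\<not> interleave (- s (n - 1 - i)) (- m (n - 1 - j) (n - 1 - i)) (- s (n - 1 - k)) (- m (n - 1 - l) (n - 1 - k))"
      unfolding flip comm[of "s _"]
      by (rule noninterleaved_subdivision_right[OF assms]) (use ij in auto)
    show "\<not> interleave (- m (n - 1 - j) (n - 1 - i)) (- s (n - 1 - j)) (- m (n - 1 - l) (n - 1 - k)) (- s (n - 1 - l))"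
      unfolding flip comm[of "m _ _"]
      by (rule noninterleaved_subdivision_left[OF assms]) (use ij in auto)
    assume "- m (n - 1 - j) (n - 1 - i) = - m (n - 1 - l) (n - 1 - k)"
    then have "n - 1 - j = n - 1 - l \<and> n - 1 - i = n - 1 - k"
      by (intro noninterleaved_subdivision_inj[OF assms]) (use ij in auto)
    then show "i = k" "j = l"
      using ij by auto
  next
    fix i j k assume "i < j" "j < n" "k < n"
    then show "- m (n - 1 - j) (n - 1 - i) \<noteq> - s (n - 1 - k)"
      using noninterleaved_subdivision_neq[OF assms, of "n - 1 - j" "n - 1 - i" "n - 1 - k"] by simp
  qed
qed

lemma not_all_after:
  assumes "noninterleaved_subdivision 6 s m" "\<And>i j. i < j \<Longrightarrow> j < 6 \<Longrightarrow> s j < m i j"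
  shows False
  using not_all_before[OF noninterleaved_subdivision_mirror[OF assms(1)]] assms(2) by auto

lemma not_all_between:
  assumes D: "noninterleaved_subdivision 6 s m"
    and between: "\<And>i j. i < j \<Longrightarrow> j < 6 \<Longrightarrow> s i < m i j \<and> m i j < s j"
  shows False
proof -
  note left = noninterleaved_subdivision_left[OF D] and right = noninterleaved_subdivision_right[OF D]
    and s = noninterleaved_subdivision_mono[OF D] and neq = noninterleaved_subdivision_neq[OF D]
  have not_inside: "\<not> (s (Suc i) < m i j \<and> m i j < s (j - 1))" if "Suc i < j" "j < 6" for i j
  proof
    assume *: "s (Suc i) < m i j \<and> m i j < s (j - 1)"
    have **: "Suc i < j - 1"
      using * that s[of "j - 1" "Suc i"] by (cases "Suc i = j - 1") force+
    \<comment> \<open>The pair just inside i, j. Its subdivision vertex lies between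
      \<open>s k\<close> and \<open>s l\<close>: if \<open>m i j\<close> is to the left of it, the
      lower halves interleave, and if to the right, the upper halves do.\<close>
    define k l where "k = Suc i" and "l = j - 1"
    have kl: "i < k" "k < l" "l < j"
      using that ** by (auto simp: k_def l_def)
    have facts: "s i < s k" "s l < s j" "s k < m k l" "m k l < s l" "s k < m i j" "m i j < s l"
      using s[of i k] s[of l j] between[of k l] that kl * by (auto simp: k_def l_def)
    consider "m i j < m k l" | "m k l < m i j" | "m i j = m k l"
      by linarith
    then show False
    proof cases
      case 1
      then have "interleave (s i) (m i j) (s k) (m k l)"
        using facts by (intro interleaveI) auto
      then show False
        using left[of i j k l] that kl by simp
    next
      case 2
      then have "interleave (m k l) (s l) (m i j) (s j)"
        using facts by (intro interleaveI) auto
      then show False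
        using right[of k l i j] that kl by simp
    next
      case 3
      then show False
        using noninterleaved_subdivision_inj[OF D, of i j k l] that kl by simp
    qed
  qed
  \<comment> \<open>By the previous step \<open>m i j\<close> is close to \<open>s i\<close> or to \<open>s j\<close>. Interleaved pairs make different choices,
    so three pairwise interleaved pairs are impossible.\<close>
  have alternate: "(m i j < s (Suc i)) \<noteq> (m k l < s (Suc k))"
    if "i < k" "k < j" "j < l" "l < 6" for i j k l
  proof
    assume *: "(m i j < s (Suc i)) = (m k l < s (Suc k))"
    have mono: "s a \<le> s b" if "a \<le> b" "b < 6" for a b
      using s[of a b] that by (cases "a = b") auto
    have order: "s i < s k" "s (Suc i) \<le> s k" "s (Suc k) \<le> s j" "s k \<le> s (j - 1)"
      "s j < s l" "s j \<le> s (l - 1)"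
      using that by (auto intro: s mono)
    have m: "s i < m i j" "m i j < s j" "s k < m k l" "m k l < s l"
      using between[of i j] between[of k l] that by auto
    show False
    proof (cases "m i j < s (Suc i)")
      case True
      then have "interleave (m i j) (s j) (m k l) (s l)"
        using * order m by (intro interleaveI) auto
      then show False
        using right[of i j k l] that by simp
    next
      case False
      then have "s (j - 1) < m i j" "s (l - 1) < m k l"
        using * not_inside[of i j] not_inside[of k l] that
          neq[of i j "Suc i"] neq[of i j "j - 1"] neq[of k l "Suc k"] neq[of k l "l - 1"]
        by (auto simp: linorder_neq_iff)
      then have "interleave (s i) (m i j) (s k) (m k l)"
        using order m by (intro interleaveI) auto
      then show False
        using left[of i j k l] that by simp
    qed
  qed
  have "(m 0 3 < s 1) \<noteq> (m 1 4 < s 2)" "(m 0 3 < s 1) \<noteq> (m 2 5 < s 3)" "(m 1 4 < s 2) \<noteq> (m 2 5 < s 3)"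
    using alternate[of 0 1 3 4] alternate[of 1 2 4 5] alternate[of 0 2 3 5] by (simp_all add: numeral_eq_Suc)
  then show False by auto
qed

text \<open>What remains of a drawing in convex position with k layers: places on the spine and the
  layers \<open>A\<close> and \<open>B\<close> of the lower and upper half of each subdivided edge.
  Where all values of \<open>A\<close> agree and all values of \<open>B\<close> agree, it becomes
  \<open>noninterleaved_subdivision\<close>.\<close>

definition paged_subdivision ::
    "nat \<Rightarrow> nat \<Rightarrow> (nat \<Rightarrow> real) \<Rightarrow> (nat \<Rightarrow> nat \<Rightarrow> real) \<Rightarrow> (nat \<Rightarrow> nat \<Rightarrow> nat) \<Rightarrow> (nat \<Rightarrow> nat \<Rightarrow> nat) \<Rightarrow> bool" where
  "paged_subdivision n k s m A B \<longleftrightarrow>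
     (\<forall>i j. i < j \<and> j < n \<longrightarrow> s i < s j) \<and>
     (\<forall>i j i' j'. i < j \<and> j < n \<and> i' < j' \<and> j' < n \<and> m i j = m i' j' \<longrightarrow> i = i' \<and> j = j') \<and>
     (\<forall>i j l. i < j \<and> j < n \<and> l < n \<longrightarrow> m i j \<noteq> s l) \<and>
     (\<forall>i j. i < j \<and> j < n \<longrightarrow> A i j < k \<and> B i j < k) \<and>
     (\<forall>i j i' j'. i < j \<and> j < n \<and> i' < j' \<and> j' < n \<longrightarrow>
        (A i j = A i' j' \<longrightarrow> \<not> interleave (s i) (m i j) (s i') (m i' j')) \<and>
        (B i j = B i' j' \<longrightarrow> \<not> interleave (m i j) (s j) (m i' j') (s j')))"

lemma Ramsey_paged_subdivision:
  fixes k :: nat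
  shows "\<exists>N. \<forall>s m A B. \<not> paged_subdivision N k s m A B"
proof -
  obtain N :: nat where N: "\<forall>f :: nat \<Rightarrow> nat \<Rightarrow> (bool \<times> bool) \<times> nat \<times> nat.
      (\<forall>i j. i < j \<and> j < N \<longrightarrow> f i j \<in> UNIV \<times> {..<k} \<times> {..<k}) \<longrightarrow>
    (\<exists>x c. strict_mono_on {..<6::nat} x \<and> x ` {..<6} \<subseteq> {..<N} \<and>
      (\<forall>i j. i < j \<and> j < 6 \<longrightarrow> f (x i) (x j) = c))"
    using ramsey_pairs[of "(UNIV :: (bool \<times> bool) set) \<times> {..<k} \<times> {..<k}" 6] by auto
  have "\<not> paged_subdivision N k s m A B" for s m A B
  proof
    assume P: "paged_subdivision N k s m A B"
    note P1 = P[unfolded paged_subdivision_def]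
    have s: "s i < s j" if "i < j" "j < N" for i j
      using P1[THEN conjunct1] that by blast
    have inj: "i = i' \<and> j = j'" if "i < j" "j < N" "i' < j'" "j' < N" "m i j = m i' j'" for i j i' j'
      using P1[THEN conjunct2, THEN conjunct1] that by blast
    have neq: "m i j \<noteq> s l" if "i < j" "j < N" "l < N" for i j l
      using P1[THEN conjunct2, THEN conjunct2, THEN conjunct1] that by blast
    have pages: "A i j < k \<and> B i j < k" if "i < j" "j < N" for i j
      using P1[THEN conjunct2, THEN conjunct2, THEN conjunct2, THEN conjunct1] that by blast
    note no = P1[THEN conjunct2, THEN conjunct2, THEN conjunct2, THEN conjunct2, rule_format,
        OF conjI, OF _ conjI, OF _ _ conjI]
    \<comment> \<open>Two comparisons encode the three positions, because \<open>m i j\<close> never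
      equals \<open>s i\<close> or \<open>s j\<close>. There are 4 k^2 colours, so N depends on k
      alone.\<close>
    define f where "f i j = ((m i j < s i, m i j < s j), A i j, B i j)" for i j
    have range: "\<forall>i j. i < j \<and> j < N \<longrightarrow> f i j \<in> UNIV \<times> {..<k} \<times> {..<k}"
      using pages by (simp add: f_def)
    obtain x :: "nat \<Rightarrow> nat" and c where xc: "strict_mono_on {..<6} x \<and> x ` {..<6} \<subseteq> {..<N} \<and>
        (\<forall>i j. i < j \<and> j < 6 \<longrightarrow> f (x i) (x j) = c)"
      using N[THEN spec, of f, THEN mp, OF range] by (elim exE) (rule that)
    then have x: "strict_mono_on {..<6} x" "x ` {..<6} \<subseteq> {..<N}"
      by simp_all
    have c: "f (x i) (x j) = c" if "i < j" "j < 6" for i j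
      using xc that by simp
    have xlt: "x i < x j" if "i < j" "j < 6" for i j
      using x(1) that by (auto simp: strict_mono_on_def)
    have xN: "x i < N" if "i < 6" for i
      using x(2) that by auto
    define s' where "s' i = s (x i)" for i
    define m' where "m' i j = m (x i) (x j)" for i j
    have xeq: "i = k" if "x i = x k" "i < 6" "k < 6" for i k
      using xlt[of i k] xlt[of k i] that by (cases i k rule: linorder_cases) auto
    have D: "noninterleaved_subdivision 6 s' m'"
      unfolding noninterleaved_subdivision_def
    proof (intro conjI allI impI; elim conjE)
      show "s' i < s' j" if "i < j" "j < 6" for i j
        using that by (simp add: s'_def s xlt xN)
      show "m' i j \<noteq> s' k" if "i < j" "j < 6" "k < 6" for i j k
        using that by (simp add: s'_def m'_def neq xlt xN)
      fix i j k l :: nat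
      assume ij: "i < j" "j < 6" "k < l" "l < 6"
      then have less: "x i < x j" "x j < N" "x k < x l" "x l < N"
        by (auto simp: xlt xN)
      have "A (x i) (x j) = A (x k) (x l)" "B (x i) (x j) = B (x k) (x l)"
        using c[of i j] c[of k l] ij by (auto simp: f_def)
      then show "\<not> interleave (s' i) (m' i j) (s' k) (m' k l)"
        "\<not> interleave (m' i j) (s' j) (m' k l) (s' l)"
        using no[OF less] unfolding s'_def m'_def by simp_all
      assume "m' i j = m' k l"
      then have "x i = x k" "x j = x l"
        using inj less unfolding m'_def by blast+
      then show "i = k" "j = l"
        using xeq ij by auto
    qed
    have type: "(m' i j < s' i, m' i j < s' j) = fst c" if "i < j" "j < 6" for i j
      using c[OF that] by (auto simp: f_def s'_def m'_def)
    have neq': "m' i j \<noteq> s' i" "m' i j \<noteq> s' j" if "i < j" "j < 6" for i j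
      using noninterleaved_subdivision_neq[OF D] that by auto
    show False
    proof (cases "fst (fst c)")
      case True
      then have "m' i j < s' i" if "i < j" "j < 6" for i j
        using type[OF that] by (metis fst_conv)
      then show False
        by (rule not_all_before[OF D])
    next
      case before: False
      show False
      proof (cases "snd (fst c)")
        case True
        then have "s' i < m' i j \<and> m' i j < s' j" if "i < j" "j < 6" for i j
          using type[OF that] before neq'[OF that] by (metis fst_conv snd_conv linorder_neqE)
        then show False
          by (rule not_all_between[OF D])
      next
        case False
        then have "s' j < m' i j" if "i < j" "j < 6" for i j
          using type[OF that] neq'[OF that] by (metis snd_conv linorder_neqE)
        then show False
          by (rule not_all_after[OF D])
      qed
    qed
  qed
  then show ?thesis
    by blast
qed

section \<open>Points in convex position\<close>

lemma edge_segment_doubleton: "edge_segment p {u, v} = closed_segment (p u) (p v)"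
  by (simp add: edge_segment_def segment_convex_hull)

text \<open>Twice the signed area of the triangle a b c, positive for a counterclockwise
  turn.\<close>

definition orient :: "real^2 \<Rightarrow> real^2 \<Rightarrow> real^2 \<Rightarrow> real" where
  "orient a b c = (b$1 - a$1) * (c$2 - a$2) - (b$2 - a$2) * (c$1 - a$1)"

lemma real2_eq_iff: "(x :: real^2) = y \<longleftrightarrow> x$1 = y$1 \<and> x$2 = y$2"
  by (simp add: vec_eq_iff forall_2)

lemma orient_swap: "orient a c b = - orient a b c"
  by (simp add: orient_def algebra_simps)

text \<open>The affine dependence \<open>orient b c d * a + orient a b d * c = orient a c d * b +
  orient a b c * d\<close> has the same coefficient sum \<open>D\<close> on both sides. Divided by
  \<open>D\<close>, it exhibits one point as a convex combination of a, c and of b, d.\<close>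

lemma segments_meet:
  assumes "orient a b c > 0" "orient a b d > 0" "orient a c d > 0" "orient b c d > 0"
  shows "closed_segment a c \<inter> closed_segment b d \<noteq> {}"
proof -
  define D where "D = orient a b c + orient a c d"
  have "D > 0"
    using assms by (simp add: D_def)
  have D: "D = orient a b d + orient b c d"
    by (simp add: D_def orient_def algebra_simps)
  define x where "x = (orient b c d / D) *\<^sub>R a + (orient a b d / D) *\<^sub>R c"
  have "x = (1 - orient a b d / D) *\<^sub>R a + (orient a b d / D) *\<^sub>R c"
    using \<open>D > 0\<close> unfolding x_def D by (simp add: diff_divide_eq_iff)
  then have 1: "x \<in> closed_segment a c"
    using \<open>D > 0\<close> assms D unfolding closed_segment_def by (intro CollectI exI[of _ "orient a b d / D"]) auto
  have "D *\<^sub>R x = orient b c d *\<^sub>R a + orient a b d *\<^sub>R c"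
    using \<open>D > 0\<close> by (simp add: x_def scaleR_add_right)
  also have "\<dots> = orient a c d *\<^sub>R b + orient a b c *\<^sub>R d"
    by (simp add: real2_eq_iff orient_def algebra_simps)
  finally have "inverse D *\<^sub>R D *\<^sub>R x = inverse D *\<^sub>R (orient a c d *\<^sub>R b + orient a b c *\<^sub>R d)"
    by (rule arg_cong)
  then have "x = (orient a c d / D) *\<^sub>R b + (orient a b c / D) *\<^sub>R d"
    using \<open>D > 0\<close> by (simp add: scaleR_add_right divide_inverse mult.commute)
  also have "orient a c d / D = 1 - orient a b c / D"
    using \<open>D > 0\<close> unfolding D_def by (simp add: field_simps)
  finally have "x \<in> closed_segment b d"
    using \<open>D > 0\<close> assms unfolding closed_segment_def
    by (intro CollectI exI[of _ "orient a b c / D"]) (auto simp: D_def)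
  with 1 show ?thesis by auto
qed

lemma convex_position_not_in_hull:
  assumes "convex_position S" "x \<in> S"
  shows "x \<notin> convex hull (S - {x})"
proof -
  have "convex (convex hull S - {x})"
    using assms extreme_point_of_stillconvex[OF convex_convex_hull] by (auto simp: convex_position_def)
  then have "convex hull (S - {x}) \<subseteq> convex hull S - {x}"
    using hull_subset[of S convex] by (intro hull_minimal) auto
  then show ?thesis by auto
qed

text \<open>Cramer's rule gives the barycentric coordinates of b in the triangle p a c as quotients
  of orientations; the hypotheses are exactly their signs.\<close>

lemma in_triangle:
  assumes "orient p a b \<ge> 0" "orient p b c \<ge> 0" "orient a b c \<le> 0" "orient p a c > 0"
  shows "b \<in> convex hull {p, a, c}"
proof -
  have "inverse (orient p a c) *\<^sub>R orient p a c *\<^sub>R b =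
      inverse (orient p a c) *\<^sub>R ((- orient a b c) *\<^sub>R p + orient p b c *\<^sub>R a + orient p a b *\<^sub>R c)"
    by (rule arg_cong) (simp add: real2_eq_iff orient_def algebra_simps)
  then have "b = (- orient a b c / orient p a c) *\<^sub>R p + (orient p b c / orient p a c) *\<^sub>R a
      + (orient p a b / orient p a c) *\<^sub>R c"
    using assms by (simp add: scaleR_add_right scaleR_diff_right divide_inverse mult.commute)
  moreover have "- orient a b c / orient p a c + orient p b c / orient p a c + orient p a b / orient p a c = 1"
  proof -
    have "- orient a b c + orient p b c + orient p a b = orient p a c"
      by (simp add: orient_def algebra_simps)
    then have "(- orient a b c + orient p b c + orient p a b) / orient p a c = 1"
      using assms by simp
    then show ?thesis
      by (simp add: add_divide_distrib diff_divide_distrib)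
  qed
  moreover have "- orient a b c / orient p a c \<ge> 0" "orient p b c / orient p a c \<ge> 0"
    "orient p a b / orient p a c \<ge> 0"
    using assms by (auto intro: divide_nonneg_pos divide_nonpos_pos)
  ultimately show ?thesis
    unfolding convex_hull_3 by blast
qed

text \<open>The key is the slope as seen from \<open>p\<close>, with the normal \<open>w\<close> of a line separating \<open>p\<close> from the
  other points as the horizontal axis.\<close>

lemma convex_position_key:
  assumes "finite S" "convex_position S" "p \<in> S"
  shows "\<exists>key :: real^2 \<Rightarrow> real. inj_on key (S - {p}) \<and>
    (\<forall>a b c d. {a, b, c, d} \<subseteq> S - {p} \<longrightarrow> key a < key b \<longrightarrow> key b < key c \<longrightarrow> key c < key d \<longrightarrow>
       closed_segment a c \<inter> closed_segment b d \<noteq> {})"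
proof -
  note notin = convex_position_not_in_hull[OF assms(2)]
  have "closed (convex hull (S - {p}))"
    using assms by (intro compact_imp_closed finite_imp_compact_convex_hull) auto
  then obtain w \<beta> where w: "w \<bullet> p < \<beta>" "\<And>x. x \<in> S - {p} \<Longrightarrow> \<beta> < w \<bullet> x"
    using separating_hyperplane_closed_point[OF convex_convex_hull, of "S - {p}" p] notin[OF assms(3)]
    by (metis hull_inc)
  define h where "h x = w \<bullet> (x - p)" for x
  define key where "key x = (w$1 * (x$2 - p$2) - w$2 * (x$1 - p$1)) / h x" for x
  have h: "h x > 0" if "x \<in> S - {p}" for x
    using w(1) w(2)[OF that] by (simp add: h_def inner_diff_right)
  have h_alt: "h x = w$1 * (x$1 - p$1) + w$2 * (x$2 - p$2)" for x
    by (simp add: h_def inner_vec_def sum_2)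
  \<comment> \<open>Up to positive factors the difference is \<open>orient p u v\<close>: increasing
    key is counterclockwise order as seen from p.\<close>
  have diff: "key v - key u = (w \<bullet> w) * orient p u v / (h u * h v)" if "u \<in> S - {p}" "v \<in> S - {p}" for u v
  proof -
    have "(w$1 * (v$2 - p$2) - w$2 * (v$1 - p$1)) * h u - (w$1 * (u$2 - p$2) - w$2 * (u$1 - p$1)) * h v
      = (w \<bullet> w) * orient p u v"
      by (simp add: h_alt orient_def inner_vec_def sum_2 algebra_simps)
    then show ?thesis
      using h[OF that(1)] h[OF that(2)] by (simp add: key_def divide_simps algebra_simps)
  qed
  have ww: "w \<bullet> w > 0" if "u \<in> S - {p}" for u
    using h[OF that] by (auto simp: h_def)
  have pos: "orient p u v > 0" if "u \<in> S - {p}" "v \<in> S - {p}" "key u < key v" for u v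
  proof -
    have "0 < (w \<bullet> w) * orient p u v / (h u * h v)"
      using diff[OF that(1,2)] that(3) by simp
    moreover have "0 < h u * h v"
      using h[OF that(1)] h[OF that(2)] by simp
    ultimately have "0 < (w \<bullet> w) * orient p u v"
      by (metis pos_less_divide_eq mult_zero_left)
    then show ?thesis
      using ww[OF that(1)] by (rule zero_less_mult_pos)
  qed
  \<comment> \<open>Seen from p, b lies between a and c; without a left turn at b it would fall into
    the triangle p a c, against convex position.\<close>
  have turn: "orient a b c > 0" if "{a, b, c} \<subseteq> S - {p}" "key a < key b" "key b < key c" for a b c
  proof (rule ccontr)
    assume "\<not> orient a b c > 0"
    then have "b \<in> convex hull {p, a, c}"
      using that pos[of a b] pos[of b c] pos[of a c] by (intro in_triangle) auto
    moreover have "convex hull {p, a, c} \<subseteq> convex hull (S - {b})"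
      using that assms(3) by (intro hull_mono) auto
    ultimately show False
      using notin[of b] that by auto
  qed
  \<comment> \<open>Points with equal keys lie on one ray from p, since \<open>h\<close> is positive
    on both; the one with the smaller \<open>h\<close> then lies between p and the other.\<close>
  have no_seg: False if "u \<in> S - {p}" "v \<in> S - {p}" "u \<noteq> v" "orient p u v = 0" "h u \<le> h v" for u v
  proof -
    have hv: "h v > 0" "h u > 0" using h that by auto
    have "h v *\<^sub>R (u - p) = h u *\<^sub>R (v - p)"
      using that(4) unfolding h_alt orient_def by (simp add: real2_eq_iff) (auto, algebra+)
    then have "u - p = (h u / h v) *\<^sub>R (v - p)"
      using hv by (simp add: real2_eq_iff field_simps)
    then have "u = (1 - h u / h v) *\<^sub>R p + (h u / h v) *\<^sub>R v"
      by (simp add: algebra_simps)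
    then have "u \<in> closed_segment p v"
      using hv that(5) unfolding closed_segment_def by (auto intro!: exI[of _ "h u / h v"])
    moreover have "closed_segment p v \<subseteq> convex hull (S - {u})"
      unfolding segment_convex_hull using that assms(3) by (intro hull_mono) auto
    ultimately show False
      using notin[of u] that by auto
  qed
  show ?thesis
  proof (intro exI[of _ key] conjI allI impI)
    show "inj_on key (S - {p})"
    proof (rule inj_onI, rule ccontr)
      fix u v assume uv: "u \<in> S - {p}" "v \<in> S - {p}" "key u = key v" "u \<noteq> v"
      then have "orient p u v = 0"
        using diff[OF uv(1,2)] h[OF uv(1)] h[OF uv(2)] ww[OF uv(1)] by auto
      then have "orient p v u = 0"
        by (simp add: orient_swap[of p v u])
      then show False
        using no_seg[of u v] no_seg[of v u] uv \<open>orient p u v = 0\<close> by (cases "h u \<le> h v") auto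
    qed
    show "closed_segment a c \<inter> closed_segment b d \<noteq> {}"
      if "{a, b, c, d} \<subseteq> S - {p}" "key a < key b" "key b < key c" "key c < key d" for a b c d
      using that by (intro segments_meet turn) auto
  qed
qed

section \<open>From a convex drawing to an order along a spine\<close>

lemma interleave_iff:
  "interleave a b c d \<longleftrightarrow> (a < c \<and> c < b \<and> b < d) \<or> (b < c \<and> c < a \<and> a < d) \<or>
     (a < d \<and> d < b \<and> b < c) \<or> (b < d \<and> d < a \<and> a < c)"
  by (auto simp: interleave_def min_def max_def)

text \<open>Strict interleaving makes the four endpoints distinct, so the edges share no vertex and
  any common point of the segments counts as a crossing.\<close>

lemma interleave_imp_edges_cross:
  fixes key :: "real^2 \<Rightarrow> real"
  assumes meet: "\<And>a b c d. \<lbrakk>{a, b, c, d} \<subseteq> p ` W; key a < key b; key b < key c; key c < key d\<rbrakk> \<Longrightarrow>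
       closed_segment a c \<inter> closed_segment b d \<noteq> {}"
    and W: "{a, b, c, d} \<subseteq> W"
    and "interleave (key (p a)) (key (p b)) (key (p c)) (key (p d))"
  shows "{a, b} \<noteq> {c, d} \<and> edges_cross p {a, b} {c, d}"
proof -
  have "closed_segment (p a) (p b) \<inter> closed_segment (p c) (p d) \<noteq> {}"
    using assms(3) unfolding interleave_iff
    by (elim disjE conjE)
      (use meet[of "p a" "p c" "p b" "p d"] meet[of "p b" "p c" "p a" "p d"]
        meet[of "p a" "p d" "p b" "p c"] meet[of "p b" "p d" "p a" "p c"] W in
        \<open>simp add: closed_segment_commute\<close>)+
  moreover have "{a, b} \<inter> {c, d} = {}"
    using assms(3) unfolding interleave_iff by auto
  ultimately show ?thesis
    by (auto simp: edges_cross_def edge_segment_doubleton)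
qed

text \<open>The vertex \<open>sgl n\<close> serves as the viewpoint and gets no place on the spine.
  The other n are renumbered by increasing key; renumbering may reverse a pair, which is why
  \<open>mid\<close> is required to be symmetric.\<close>

lemma convex_subdivision_order:
  fixes sgl :: "nat \<Rightarrow> 'a" and mid :: "nat \<Rightarrow> nat \<Rightarrow> 'a"
  assumes "finite V" and drawing: "straight_line_drawing V E p" "convex_position (p ` V)"
    and layering: "noncrossing_layering E p k layer"
    and sgl: "\<And>i. i \<le> n \<Longrightarrow> sgl i \<in> V" "inj_on sgl {..n}"
    and mid: "\<And>i j. i < n \<Longrightarrow> j < n \<Longrightarrow> i \<noteq> j \<Longrightarrow> mid i j \<in> V"
      "\<And>i j. mid i j = mid j i"
      "\<And>i j i' j'. mid i j = mid i' j' \<Longrightarrow> {i, j} = {i', j'}"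
      "\<And>i j l. i \<noteq> j \<Longrightarrow> mid i j \<noteq> sgl l"
    and edges: "\<And>i j. i < n \<Longrightarrow> j < n \<Longrightarrow> i \<noteq> j \<Longrightarrow> {sgl i, mid i j} \<in> E"
  shows "\<exists>s m A B. paged_subdivision n k s m A B"
proof -
  define W where "W = V - {sgl n}"
  have pW: "p ` V - {p (sgl n)} = p ` W"
    using drawing(1) sgl(1)[of n] unfolding straight_line_drawing_def W_def inj_on_def by blast
  obtain key :: "real^2 \<Rightarrow> real" where key: "inj_on key (p ` W)"
    "\<forall>a b c d. {a, b, c, d} \<subseteq> p ` W \<longrightarrow> key a < key b \<longrightarrow> key b < key c \<longrightarrow> key c < key d \<longrightarrow>
       closed_segment a c \<inter> closed_segment b d \<noteq> {}"
    using convex_position_key[OF finite_imageI[OF \<open>finite V\<close>] drawing(2) imageI[OF sgl(1)[OF order_refl]]]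
    unfolding pW by (elim exE conjE) (rule that)
  define \<kappa> where "\<kappa> v = key (p v)" for v
  have \<kappa>_inj: "inj_on \<kappa> W"
    using key(1) drawing(1) unfolding \<kappa>_def straight_line_drawing_def W_def inj_on_def by blast
  have sglW: "sgl i \<in> W" if "i < n" for i
    using sgl that by (auto simp: W_def inj_on_def)
  have midW: "mid i j \<in> W" if "i < n" "j < n" "i \<noteq> j" for i j
    using mid(1)[OF that] mid(4)[OF that(3)] by (auto simp: W_def)
  define L where "L = sorted_list_of_set ((\<lambda>i. \<kappa> (sgl i)) ` {..<n})"
  have "inj_on (\<lambda>i. \<kappa> (sgl i)) {..<n}"
    using \<kappa>_inj sgl(2) sglW by (auto simp: inj_on_def)
  then have len: "length L = n"
    by (simp add: L_def card_image)
  have "\<exists>l. l < n \<and> \<kappa> (sgl l) = L ! i" if "i < n" for i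
  proof -
    have "L ! i \<in> set L"
      using that len by simp
    then show ?thesis
      by (auto simp: L_def)
  qed
  \<comment> \<open>\<open>\<pi> i\<close> is the old index of the vertex with the i-th smallest
    key.\<close>
  then obtain \<pi> where \<pi>: "\<And>i. i < n \<Longrightarrow> \<pi> i < n \<and> \<kappa> (sgl (\<pi> i)) = L ! i"
    by metis
  define s where "s i = \<kappa> (sgl (\<pi> i))" for i
  define m where "m i j = \<kappa> (mid (\<pi> i) (\<pi> j))" for i j
  define A where "A i j = layer {sgl (\<pi> i), mid (\<pi> i) (\<pi> j)}" for i j
  define B where "B i j = layer {sgl (\<pi> j), mid (\<pi> j) (\<pi> i)}" for i j
  have s: "s i < s j" if "i < j" "j < n" for i j
  proof -
    have "sorted_wrt (<) L"
      unfolding L_def by (rule strict_sorted_list_of_set)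
    then have "L ! i < L ! j"
      using that len by (auto intro: sorted_wrt_nth_less)
    then show ?thesis
      using \<pi>[of i] \<pi>[of j] that by (simp add: s_def)
  qed
  have \<pi>_neq: "\<pi> i \<noteq> \<pi> j" if "i < j" "j < n" for i j
    using s[OF that] by (auto simp: s_def)
  have \<pi>_inj: "i = j" if "\<pi> i = \<pi> j" "i < n" "j < n" for i j
    using \<pi>_neq[of i j] \<pi>_neq[of j i] that by (cases i j rule: linorder_cases) auto
  have sep: "layer {a, b} \<noteq> layer {c, d}"
    if "{a, b} \<in> E" "{c, d} \<in> E" "{a, b, c, d} \<subseteq> W" "interleave (\<kappa> a) (\<kappa> b) (\<kappa> c) (\<kappa> d)" for a b c d
  proof -
    have "{a, b} \<noteq> {c, d} \<and> edges_cross p {a, b} {c, d}"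
      by (rule interleave_imp_edges_cross[of p W key, OF key(2)[rule_format]])
        (use that in \<open>simp_all add: \<kappa>_def\<close>)
    then show ?thesis
      using layering that(1,2) unfolding noncrossing_layering_def by metis
  qed
  have "paged_subdivision n k s m A B"
    unfolding paged_subdivision_def
  proof (intro conjI allI impI; elim conjE)
    fix i j assume ij: "i < j" "j < n"
    show "s i < s j" by (rule s[OF ij])
    have less: "\<pi> i < n" "\<pi> j < n" "\<pi> i \<noteq> \<pi> j"
      using \<pi> ij \<pi>_neq by auto
    have E1: "{sgl (\<pi> i), mid (\<pi> i) (\<pi> j)} \<in> E" "{sgl (\<pi> j), mid (\<pi> j) (\<pi> i)} \<in> E"
      using edges less by auto
    then show "A i j < k" "B i j < k"
      using layering by (simp_all add: A_def B_def noncrossing_layering_def)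
    show "m i j \<noteq> s l" if "l < n" for l
    proof
      assume "m i j = s l"
      then have "mid (\<pi> i) (\<pi> j) = sgl (\<pi> l)"
        using inj_onD[OF \<kappa>_inj] midW sglW less \<pi>[OF that] by (simp add: m_def s_def)
      then show False
        using mid(4) less by blast
    qed
    fix i' j' assume ij': "i' < j'" "j' < n"
    have less': "\<pi> i' < n" "\<pi> j' < n" "\<pi> i' \<noteq> \<pi> j'"
      using \<pi> ij' \<pi>_neq by auto
    have E2: "{sgl (\<pi> i'), mid (\<pi> i') (\<pi> j')} \<in> E" "{sgl (\<pi> j'), mid (\<pi> j') (\<pi> i')} \<in> E"
      using edges less' by auto
    have eq: "i = i' \<and> j = j'" if "m i j = m i' j'"
    proof -
      have "mid (\<pi> i) (\<pi> j) = mid (\<pi> i') (\<pi> j')"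
        using that inj_onD[OF \<kappa>_inj] midW less less' by (simp add: m_def)
      then have "{\<pi> i, \<pi> j} = {\<pi> i', \<pi> j'}"
        by (rule mid(3))
      then have "i = i' \<and> j = j' \<or> i = j' \<and> j = i'"
        using \<pi>_inj ij ij' by (auto simp: doubleton_eq_iff)
      then show ?thesis
        using ij ij' by auto
    qed
    show "i = i'" "j = j'" if "m i j = m i' j'"
      using eq that by blast+
    show "\<not> interleave (s i) (m i j) (s i') (m i' j')" if "A i j = A i' j'"
      using sep[OF E1(1) E2(1)] less less' midW sglW that unfolding A_def s_def m_def by auto
    have "interleave a b c d \<longleftrightarrow> interleave b a d c" for a b c d
      by (auto simp: interleave_iff)
    then show "\<not> interleave (m i j) (s j) (m i' j') (s j')" if "B i j = B i' j'"
      using sep[OF E1(2) E2(2)] less less' midW sglW mid(2)[of "\<pi> i" "\<pi> j"] mid(2)[of "\<pi> i'" "\<pi> j'"] that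
      unfolding B_def s_def m_def by auto
  qed
  then show ?thesis
    by blast
qed

section \<open>Crossings among five points\<close>

lemma orient_eq_0_imp_between:
  assumes "orient a b c = 0" "a \<noteq> b"
  shows "c \<in> closed_segment a b \<or> b \<in> closed_segment a c \<or> a \<in> closed_segment b c"
proof -
  have "\<exists>r. c = a + r *\<^sub>R (b - a)"
  proof (cases "b$1 = a$1")
    case True
    then have "b$2 - a$2 \<noteq> 0" using assms(2) by (simp add: real2_eq_iff)
    moreover from this have "c$1 = a$1"
      using assms(1) True by (simp add: orient_def)
    ultimately have "c = a + ((c$2 - a$2) / (b$2 - a$2)) *\<^sub>R (b - a)"
      using True by (simp add: real2_eq_iff)
    then show ?thesis ..
  next
    case False
    then have "c$2 - a$2 = (c$1 - a$1) / (b$1 - a$1) * (b$2 - a$2)"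
      using assms(1) by (simp add: orient_def eq_divide_eq mult.commute)
    then have "c = a + ((c$1 - a$1) / (b$1 - a$1)) *\<^sub>R (b - a)"
      using False by (simp add: real2_eq_iff)
    then show ?thesis ..
  qed
  then obtain r where r: "c = a + r *\<^sub>R (b - a)" ..
  consider "0 \<le> r \<and> r \<le> 1" | "r > 1" | "r < 0" by linarith
  then show ?thesis
  proof cases
    case 1
    then have "c \<in> closed_segment a b"
      unfolding in_segment r by (intro exI[of _ r]) (simp add: algebra_simps)
    then show ?thesis by simp
  next
    case 2
    then have "b \<in> closed_segment a c"
      unfolding in_segment r by (intro exI[of _ "1 / r"]) (simp add: algebra_simps)
    then show ?thesis by simp
  next
    case 3
    \<comment> \<open>The weight u of b in \<open>a = (1 - u) * c + u * b\<close> solves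
      \<open>(1 - u) * r + u = 0\<close>.\<close>
    then have "a \<in> closed_segment c b"
      unfolding in_segment r
      by (intro exI[of _ "r / (r - 1)"]) (simp add: real2_eq_iff divide_simps, simp add: algebra_simps)
    then show ?thesis by (simp add: closed_segment_commute)
  qed
qed

text \<open>Of the eight sign patterns with positive product, \<open>rel\<close> excludes the two
  alternating ones. The other six form three pairs that differ by reversing all signs; each pair is
  a convex quadrilateral whose diagonals are one of the three ways to match the four points.\<close>

lemma orient_product_pos_imp_segments_meet:
  assumes "orient a b c * orient a b d * orient a c d * orient b c d > 0"
  shows "closed_segment a c \<inter> closed_segment b d \<noteq> {} \<or> closed_segment a b \<inter> closed_segment c d \<noteq> {} \<or>
    closed_segment a d \<inter> closed_segment b c \<noteq> {}"
proof -
  have rel: "orient a b c = orient a b d - orient a c d + orient b c d"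
    by (simp add: orient_def algebra_simps)
  have swaps: "orient d c b = - orient b c d" "orient d c a = - orient a c d" "orient d b a = - orient a b d"
    "orient c b a = - orient a b c" "orient a d c = - orient a c d" "orient b d c = - orient b c d"
    "orient c d b = orient b c d" "orient c d a = orient a c d"
    "orient a d b = - orient a b d" "orient d b c = orient b c d" "orient c b d = - orient b c d"
    "orient b d a = orient a b d"
    by (simp_all add: orient_def algebra_simps)
  consider "orient a b c > 0" "orient a b d > 0" "orient a c d > 0" "orient b c d > 0"
    | "orient a b c < 0" "orient a b d < 0" "orient a c d < 0" "orient b c d < 0"
    | "orient a b c > 0" "orient a b d > 0" "orient a c d < 0" "orient b c d < 0"
    | "orient a b c < 0" "orient a b d < 0" "orient a c d > 0" "orient b c d > 0"
    | "orient a b c > 0" "orient a b d < 0" "orient a c d < 0" "orient b c d > 0"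
    | "orient a b c < 0" "orient a b d > 0" "orient a c d > 0" "orient b c d < 0"
    using assms rel by (auto simp: zero_less_mult_iff mult_less_0_iff)
  then show ?thesis
  proof cases
    case 1 then show ?thesis using segments_meet[of a b c d] by simp
  next
    case 2 then show ?thesis using segments_meet[of d c b a] swaps by (simp add: closed_segment_commute Int_commute)
  next
    case 3 then show ?thesis using segments_meet[of a b d c] swaps by simp
  next
    case 4 then show ?thesis using segments_meet[of c d b a] swaps by (simp add: closed_segment_commute Int_commute)
  next
    case 5 then show ?thesis using segments_meet[of a d b c] swaps by (simp add: closed_segment_commute)
  next
    case 6 then show ?thesis using segments_meet[of c b d a] swaps by (simp add: closed_segment_commute Int_commute)
  qed
qed

text \<open>Four points in general position admit two disjoint pairs whose segments meet unless the
  product of their four orientations is negative. Each of the ten triples of five points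
  lies in exactly two quadruples, so the five products cannot all be negative.\<close>

lemma five_points_segments_meet:
  fixes q :: "nat \<Rightarrow> real^2"
  assumes "inj_on q {..<5}"
  shows "\<exists>i j k l. {i, j, k, l} \<subseteq> {..<5} \<and> card {i, j, k, l} = 4 \<and>
    closed_segment (q i) (q j) \<inter> closed_segment (q k) (q l) \<noteq> {}"
proof (rule ccontr)
  assume "\<not> ?thesis"
  then have disj: "closed_segment (q i) (q j) \<inter> closed_segment (q k) (q l) = {}"
    if "{i, j, k, l} \<subseteq> {..<5}" "distinct [i, j, k, l]" for i j k l
    using that by auto
  have nz: "orient (q i) (q j) (q k) \<noteq> 0" if "i < j" "j < k" "k < 5" for i j k
  proof
    assume "orient (q i) (q j) (q k) = 0"
    moreover have "q i \<noteq> q j"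
      using inj_onD[OF assms, of i j] that by auto
    ultimately have *: "q k \<in> closed_segment (q i) (q j) \<or> q j \<in> closed_segment (q i) (q k) \<or>
        q i \<in> closed_segment (q j) (q k)"
      by (rule orient_eq_0_imp_between)
    \<comment> \<open>If three points are collinear, one lies on the segment between the others;
      joining it to a fourth point gives two segments without common index that meet.\<close>
    have "\<exists>l<5. l \<noteq> i \<and> l \<noteq> j \<and> l \<noteq> k"
    proof (rule ccontr)
      assume "\<not> ?thesis"
      then have "{..<5} \<subseteq> {i, j, k}" by auto
      then have "card {..<5::nat} \<le> card {i, j, k}" by (intro card_mono) auto
      then show False using that by simp
    qed
    then obtain l where l: "l < 5" "l \<noteq> i" "l \<noteq> j" "l \<noteq> k" by blast
    show False
      using * disj[of i j k l] disj[of i k j l] disj[of j k i l] l that by auto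
  qed
  have neg: "orient (q i) (q j) (q k) * orient (q i) (q j) (q l) * orient (q i) (q k) (q l) *
      orient (q j) (q k) (q l) < 0" (is "?p < 0") if "i < j" "j < k" "k < l" "l < 5" for i j k l
  proof -
    have "?p \<noteq> 0" using nz that by simp
    moreover have "\<not> ?p > 0"
      using orient_product_pos_imp_segments_meet[of "q i" "q j" "q k" "q l"]
        disj[of i k j l] disj[of i j k l] disj[of i l j k] that by auto
    ultimately show ?thesis by linarith
  qed
  define o3 where "o3 i j k = orient (q i) (q j) (q k)" for i j k
  define o4 where "o4 i j k l = o3 i j k * o3 i j l * o3 i k l * o3 j k l" for i j k l
  have "o4 0 1 2 3 < 0" "o4 0 1 2 4 < 0" "o4 0 1 3 4 < 0" "o4 0 2 3 4 < 0" "o4 1 2 3 4 < 0"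
    unfolding o4_def o3_def by (rule neg; simp)+
  then have "o4 0 1 2 3 * o4 0 1 2 4 * (o4 0 1 3 4 * o4 0 2 3 4) * o4 1 2 3 4 < 0"
    by (simp add: mult_less_0_iff zero_less_mult_iff)
  moreover have "o4 0 1 2 3 * o4 0 1 2 4 * (o4 0 1 3 4 * o4 0 2 3 4) * o4 1 2 3 4 =
    (o3 0 1 2 * o3 0 1 3 * o3 0 2 3 * o3 1 2 3 * o3 0 1 4 * o3 0 2 4 * o3 1 2 4 * o3 0 3 4 * o3 1 3 4 * o3 2 3 4)\<^sup>2"
    by (simp add: o4_def power2_eq_square)
  ultimately show False
    by (metis not_less zero_le_power2)
qed

section \<open>A drawing with two layers\<close>

lemma not_edges_cross_if_separated:
  assumes "\<And>v. v \<in> e \<Longrightarrow> w \<bullet> p v < c" "\<And>v. v \<in> f \<Longrightarrow> c \<le> w \<bullet> p v"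
  shows "\<not> edges_cross p e f"
proof -
  have "edge_segment p e \<subseteq> {x. w \<bullet> x < c}" "edge_segment p f \<subseteq> {x. w \<bullet> x \<ge> c}"
    unfolding edge_segment_def using assms convex_halfspace_lt[of w c] convex_halfspace_ge[of c w]
    by (intro hull_minimal; force)+
  then show ?thesis
    by (fastforce simp: edges_cross_def)
qed

lemma edges_cross_commute: "edges_cross p e f \<longleftrightarrow> edges_cross p f e"
  by (simp add: edges_cross_def Int_commute)

lemma not_edges_cross_if_star:
  assumes "orient (p u) (p v) (p w) \<noteq> 0"
  shows "\<not> edges_cross p {u, v} {u, w}"
proof
  assume "edges_cross p {u, v} {u, w}"
  then obtain x where x: "x \<in> closed_segment (p u) (p v)" "x \<in> closed_segment (p u) (p w)" "x \<noteq> p u"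
    by (auto simp: edges_cross_def edge_segment_doubleton)
  obtain r where r: "x = (1 - r) *\<^sub>R p u + r *\<^sub>R p v"
    using x(1) by (auto simp: in_segment)
  obtain t where t: "x = (1 - t) *\<^sub>R p u + t *\<^sub>R p w"
    using x(2) by (auto simp: in_segment)
  have rt: "r * (p v $ i - p u $ i) = t * (p w $ i - p u $ i)" for i
    using arg_cong[OF trans[OF r[symmetric] t], of "\<lambda>y. y $ i"] by (simp add: algebra_simps)
  \<comment> \<open>Here r (v - u) = t (w - u), and the cross product with w - u annihilates the
    right side.\<close>
  have "r * orient (p u) (p v) (p w) = 0"
    using rt[of 1] rt[of 2] unfolding orient_def by algebra
  then have "r = 0" using assms by simp
  then show False using x(3) r by simp
qed

lemma orient_neq_0_imp_not_on_edge:
  assumes "orient (p u) (p v) x \<noteq> 0"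
  shows "x \<notin> edge_segment p {u, v}"
proof
  assume "x \<in> edge_segment p {u, v}"
  then obtain r where x: "x = (1 - r) *\<^sub>R p u + r *\<^sub>R p v"
    by (auto simp: edge_segment_doubleton in_segment)
  have "orient (p u) (p v) x = 0"
    unfolding x by (simp add: orient_def algebra_simps)
  then show False using assms by simp
qed

lemma not_on_edge_if_separated:
  assumes "\<And>v. v \<in> e \<Longrightarrow> w \<bullet> p v < c" "c \<le> w \<bullet> x"
  shows "x \<notin> edge_segment p e"
proof -
  have "edge_segment p e \<subseteq> {x. w \<bullet> x < c}"
    unfolding edge_segment_def using assms(1) convex_halfspace_lt[of w c]
    by (intro hull_minimal; force)
  then show ?thesis using assms(2) by force
qed

lemma orient_eq_inner: "orient a b x = vector [- (b$2 - a$2), b$1 - a$1] \<bullet> x - vector [- (b$2 - a$2), b$1 - a$1] \<bullet> a"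
  by (simp add: orient_def inner_vec_def sum_2 algebra_simps)

lemma not_edges_cross_if_one_side:
  assumes "orient (p a) (p b) (p c) * orient (p a) (p b) (p d) > 0"
  shows "\<not> edges_cross p {a, b} {c, d}"
proof -
  let ?w = "vector [- (p b$2 - p a$2), p b$1 - p a$1] :: real^2"
  have ab: "?w \<bullet> p a = ?w \<bullet> p b"
    by (simp add: inner_vec_def sum_2 algebra_simps)
  note o = orient_eq_inner[of "p a" "p b"]
  consider "orient (p a) (p b) (p c) > 0" "orient (p a) (p b) (p d) > 0"
    | "orient (p a) (p b) (p c) < 0" "orient (p a) (p b) (p d) < 0"
    using assms by (auto simp: zero_less_mult_iff)
  then show ?thesis
  proof cases
    case 1
    then have "\<not> edges_cross p {a, b} {c, d}"
      using ab o
      by (intro not_edges_cross_if_separated[of _ ?w p "min (?w \<bullet> p c) (?w \<bullet> p d)"]) (auto simp: min_def)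
    then show ?thesis .
  next
    case 2
    then have "\<not> edges_cross p {c, d} {a, b}"
      using ab o by (intro not_edges_cross_if_separated[of _ ?w p "?w \<bullet> p a"]) auto
    then show ?thesis by (simp add: edges_cross_commute)
  qed
qed

text \<open>A plane drawing of the complete graph on five vertices minus the edge \<open>{0, 4}\<close>: vertex 3 lies
  inside the triangle 012 and vertex 4 inside the triangle 123. All first coordinates are negative, which
  keeps this component apart from the grid below.\<close>

definition clique_x :: "nat \<Rightarrow> int" where
  "clique_x i = [-20, -8, -20, -17, -15] ! i"

definition clique_y :: "nat \<Rightarrow> int" where
  "clique_y i = [-20, -20, -8, -17, -16] ! i"

definition clique_orient :: "nat \<Rightarrow> nat \<Rightarrow> nat \<Rightarrow> int" where
  "clique_orient a b c = (clique_x b - clique_x a) * (clique_y c - clique_y a) -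
     (clique_y b - clique_y a) * (clique_x c - clique_x a)"

text \<open>Integer coordinates make this a computation. It includes the edge 04, so that it keeps
  vertices off all ten edges of the clique.\<close>

lemma clique_general_position:
  "\<forall>a\<in>{..<5}. \<forall>b\<in>{..<5}. \<forall>c\<in>{..<5}. a \<noteq> b \<and> a \<noteq> c \<and> b \<noteq> c \<longrightarrow> clique_orient a b c \<noteq> 0"
  unfolding atLeast0LessThan[symmetric] atLeastLessThan_upt by code_simp

text \<open>In general position two segments without common endpoint are disjoint exactly if one of
  them lies strictly on one side of the line through the other, so this sign test loses
  nothing.\<close>

lemma clique_noncrossing:
  "\<forall>a\<in>{..<5}. \<forall>b\<in>{..<5}. \<forall>c\<in>{..<5}. \<forall>d\<in>{..<5}.
     a \<noteq> b \<and> c \<noteq> d \<and> a \<noteq> c \<and> a \<noteq> d \<and> b \<noteq> c \<and> b \<noteq> d \<and>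
     {a, b} \<noteq> {0, 4} \<and> {c, d} \<noteq> {0, 4} \<longrightarrow>
       clique_orient a b c * clique_orient a b d > 0 \<or> clique_orient c d a * clique_orient c d b > 0"
  unfolding atLeast0LessThan[symmetric] atLeastLessThan_upt by code_simp

lemma not_edges_cross_if_coord_separated:
  assumes "\<And>v. v \<in> e \<Longrightarrow> p v $ k < c" "\<And>v. v \<in> f \<Longrightarrow> c \<le> p v $ k"
  shows "\<not> edges_cross p e f"
  using assms by (intro not_edges_cross_if_separated[of e "axis k 1" p c f]) (auto simp: inner_axis')

lemma not_on_edge_if_coord_separated:
  assumes "(\<forall>v\<in>e. p v $ k < x $ k) \<or> (\<forall>v\<in>e. x $ k < p v $ k)"
  shows "x \<notin> edge_segment p e"
  using assms
proof
  assume "\<forall>v\<in>e. p v $ k < x $ k"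
  then show ?thesis
    by (intro not_on_edge_if_separated[of e "axis k 1" p "x $ k"]) (auto simp: inner_axis')
next
  assume "\<forall>v\<in>e. x $ k < p v $ k"
  then show ?thesis
    by (intro not_on_edge_if_separated[of e "- axis k 1" p "- x $ k"]) (auto simp: inner_axis')
qed

text \<open>For \<open>i < j\<close> the vertex \<open>Inl (i, j)\<close> subdivides the edge joining \<open>Inl (i, i)\<close> and \<open>Inl (j, j)\<close>; the
  vertices \<open>Inr a\<close> form a disjoint complete graph on five vertices.\<close>

type_synonym vertex = "nat \<times> nat + nat"

definition vertices :: "nat \<Rightarrow> vertex set" where
  "vertices n = Inl ` {(i, j). i \<le> j \<and> j < n} \<union> Inr ` {..<5}"

definition low_edges :: "nat \<Rightarrow> vertex set set" where
  "low_edges n = {{Inl (i, i), Inl (i, j)} |i j. i < j \<and> j < n}"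

definition high_edges :: "nat \<Rightarrow> vertex set set" where
  "high_edges n = {{Inl (j, j), Inl (i, j)} |i j. i < j \<and> j < n}"

definition planar_clique_edges :: "vertex set set" where
  "planar_clique_edges = {{Inr a, Inr b} |a b. a < 5 \<and> b < 5 \<and> a \<noteq> b \<and> {a, b} \<noteq> {0, 4}}"

text \<open>The bracketing is the layering: the clique cannot be drawn in one layer, so its edge 04
  joins the second.\<close>

definition edges :: "nat \<Rightarrow> vertex set set" where
  "edges n = (low_edges n \<union> planar_clique_edges) \<union> (high_edges n \<union> {{Inr 0, Inr 4}})"

text \<open>Without the summand \<open>(j - i)\<^sup>2\<close> every star would collapse to a horizontal or vertical ray; with it,
  the edges of a star have distinct slopes, and since \<open>(j - i)\<^sup>2 < n\<^sup>2\<close> distinct stars of a layer stay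
  in disjoint strips of width \<open>n\<^sup>2\<close>.\<close>

fun position :: "nat \<Rightarrow> vertex \<Rightarrow> real^2" where
  "position n (Inl (i, j)) = vector [real (n\<^sup>2 * i + (j - i)\<^sup>2), real (n\<^sup>2 * j + (j - i)\<^sup>2)]"
| "position n (Inr a) = vector [of_int (clique_x a), of_int (clique_y a)]"

lemma grid_strip:
  assumes "i \<le> j" "j < n"
  shows "real (n\<^sup>2 * i) \<le> position n (Inl (i, j)) $ 1" "position n (Inl (i, j)) $ 1 < real (n\<^sup>2 * Suc i)"
    "real (n\<^sup>2 * j) \<le> position n (Inl (i, j)) $ 2" "position n (Inl (i, j)) $ 2 < real (n\<^sup>2 * Suc j)"
proof -
  have "(j - i)\<^sup>2 < n\<^sup>2"
    using assms by (intro power_strict_mono) auto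
  then have "n\<^sup>2 * i + (j - i)\<^sup>2 < n\<^sup>2 * Suc i" "n\<^sup>2 * j + (j - i)\<^sup>2 < n\<^sup>2 * Suc j"
    by auto
  then show "position n (Inl (i, j)) $ 1 < real (n\<^sup>2 * Suc i)" "position n (Inl (i, j)) $ 2 < real (n\<^sup>2 * Suc j)"
    unfolding position.simps vector_2 by (simp_all only: of_nat_less_iff)
qed simp_all

lemma grid_1_less:
  assumes "i \<le> j" "j < n" "i < i'" "i' \<le> j'" "j' < n"
  shows "position n (Inl (i, j)) $ 1 < real (n\<^sup>2 * i')" "position n (Inl (i, j)) $ 1 < position n (Inl (i', j')) $ 1"
proof -
  have "real (n\<^sup>2 * Suc i) \<le> real (n\<^sup>2 * i')"
    unfolding of_nat_le_iff using assms by (intro mult_left_mono) auto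
  then show "position n (Inl (i, j)) $ 1 < real (n\<^sup>2 * i')"
    using grid_strip(2)[OF assms(1,2)] by linarith
  then show "position n (Inl (i, j)) $ 1 < position n (Inl (i', j')) $ 1"
    using grid_strip(1)[OF assms(4,5)] by linarith
qed

lemma grid_2_less:
  assumes "i \<le> j" "j < n" "j < j'" "i' \<le> j'" "j' < n"
  shows "position n (Inl (i, j)) $ 2 < real (n\<^sup>2 * j')" "position n (Inl (i, j)) $ 2 < position n (Inl (i', j')) $ 2"
proof -
  have "real (n\<^sup>2 * Suc j) \<le> real (n\<^sup>2 * j')"
    unfolding of_nat_le_iff using assms by (intro mult_left_mono) auto
  then show "position n (Inl (i, j)) $ 2 < real (n\<^sup>2 * j')"
    using grid_strip(4)[OF assms(1,2)] by linarith
  then show "position n (Inl (i, j)) $ 2 < position n (Inl (i', j')) $ 2"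
    using grid_strip(3)[OF assms(4,5)] by linarith
qed

lemma grid_nonneg: "0 \<le> position n (Inl (i, j)) $ 1"
  by simp

lemma clique_neg:
  assumes "a < 5"
  shows "position n (Inr a) $ 1 < 0"
proof -
  have "a \<in> {0, 1, 2, 3, 4}" using assms by auto
  then show ?thesis
    by (auto simp: clique_x_def)
qed

lemma orient_clique:
  "orient (position n (Inr a)) (position n (Inr b)) (position n (Inr c)) = of_int (clique_orient a b c)"
  by (simp add: orient_def clique_orient_def)

text \<open>With \<open>d = j - i\<close> and \<open>N\<close> the square of n, the edge from
  \<open>(i, i)\<close> to \<open>(i, j)\<close> has direction \<open>(d^2, N d + d^2)\<close>. The
  cross product of two such directions is \<open>N * d * d' * (d - d')\<close>, nonzero because the
  star has distinct d.\<close>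

lemma orient_low:
  assumes "i < j" "i < j'" "j \<noteq> j'" "j < n"
  shows "orient (position n (Inl (i, i))) (position n (Inl (i, j))) (position n (Inl (i, j'))) \<noteq> 0"
proof -
  define N d d' where "N = real n ^ 2" and "d = real j - real i" and "d' = real j' - real i"
  have "orient (position n (Inl (i, i))) (position n (Inl (i, j))) (position n (Inl (i, j')))
      = d\<^sup>2 * (N * d' + d'\<^sup>2) - (N * d + d\<^sup>2) * d'\<^sup>2"
    using assms by (simp add: orient_def N_def d_def d'_def of_nat_diff algebra_simps)
  also have "\<dots> = N * d * d' * (d - d')"
    by (simp add: algebra_simps power2_eq_square)
  finally show ?thesis
    using assms by (simp add: N_def d_def d'_def)
qed

lemma orient_high:
  assumes "i < j" "i' < j" "i \<noteq> i'" "j < n"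
  shows "orient (position n (Inl (j, j))) (position n (Inl (i, j))) (position n (Inl (i', j))) \<noteq> 0"
proof -
  define N d d' where "N = real n ^ 2" and "d = real j - real i" and "d' = real j - real i'"
  have "orient (position n (Inl (j, j))) (position n (Inl (i, j))) (position n (Inl (i', j)))
      = (d\<^sup>2 - N * d) * d'\<^sup>2 - d\<^sup>2 * (d'\<^sup>2 - N * d')"
    using assms by (simp add: orient_def N_def d_def d'_def of_nat_diff algebra_simps)
  also have "\<dots> = N * d * d' * (d - d')"
    by (simp add: algebra_simps power2_eq_square)
  finally show ?thesis
    using assms by (simp add: N_def d_def d'_def)
qed

section \<open>The positions form a straight-line drawing\<close>

lemma inj_on_position: "inj_on (position n) (vertices n)"
proof (rule inj_onI)
  fix u v assume uv: "u \<in> vertices n" "v \<in> vertices n" "position n u = position n v"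
  show "u = v"
  proof (cases u; cases v)
    fix x y assume xy: "u = Inl x" "v = Inl y"
    obtain i j i' j' where "x = (i, j)" "y = (i', j')" by fastforce
    with xy have uv': "u = Inl (i, j)" "v = Inl (i', j')" by auto
    then have le: "i \<le> j" "j < n" "i' \<le> j'" "j' < n"
      using uv by (auto simp: vertices_def)
    have "\<not> i < i'" "\<not> i' < i" "\<not> j < j'" "\<not> j' < j"
      using grid_1_less[OF le(1,2) _ le(3,4)] grid_1_less[OF le(3,4) _ le(1,2)]
        grid_2_less[OF le(1,2) _ le(3,4)] grid_2_less[OF le(3,4) _ le(1,2)] uv(3)
      unfolding uv' by fastforce+
    then show ?thesis by (simp add: uv')
  next
    fix x b assume xy: "u = Inl x" "v = Inr b"
    then have "position n v $ 1 < 0" "0 \<le> position n u $ 1"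
      using grid_nonneg[of n "fst x" "snd x"] clique_neg[of b n] uv(2)
      by (auto simp: vertices_def simp del: position.simps)
    then show ?thesis using uv(3) by simp
  next
    fix a y assume xy: "u = Inr a" "v = Inl y"
    then have "position n u $ 1 < 0" "0 \<le> position n v $ 1"
      using grid_nonneg[of n "fst y" "snd y"] clique_neg[of a n] uv(1)
      by (auto simp: vertices_def simp del: position.simps)
    then show ?thesis using uv(3) by simp
  next
    fix a b assume xy: "u = Inr a" "v = Inr b"
    then have "a \<in> {0, 1, 2, 3, 4}" "b \<in> {0, 1, 2, 3, 4}"
      using uv by (auto simp: vertices_def)
    then show ?thesis
      using uv(3) xy by (auto simp: clique_x_def clique_y_def real2_eq_iff)
  qed
qed

text \<open>A grid vertex with another first index lies in another vertical strip, one with the same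
  first index is off the line by \<open>orient_low\<close>, and the clique has negative first
  coordinates.\<close>

lemma vertex_on_low_edge:
  assumes ij: "i < j" "j < n" and w: "w \<in> vertices n"
    and on: "position n w \<in> edge_segment (position n) {Inl (i, i), Inl (i, j)}"
  shows "w \<in> {Inl (i, i), Inl (i, j)}"
proof (cases w)
  case (Inl x)
  then obtain a b where ab: "w = Inl (a, b)" "a \<le> b" "b < n"
    using w by (auto simp: vertices_def)
  have "a = i"
  proof (rule ccontr)
    assume "a \<noteq> i"
    then have "a < i \<or> i < a" by auto
    then have "position n w \<notin> edge_segment (position n) {Inl (i, i), Inl (i, j)}"
      by (intro not_on_edge_if_coord_separated[where k = 1])
        (use ab ij in \<open>auto simp del: position.simps intro: grid_1_less\<close>)
    then show False using on by simp
  qed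
  then show ?thesis
    using orient_low[of i j b n] orient_neq_0_imp_not_on_edge[of "position n" "Inl (i, i)" "Inl (i, j)" "position n w"]
      on ij ab by (cases "b = i"; cases "b = j") auto
next
  case (Inr a)
  then have "position n w $ 1 < 0"
    using w clique_neg by (auto simp: vertices_def simp del: position.simps)
  then have "position n w \<notin> edge_segment (position n) {Inl (i, i), Inl (i, j)}"
    using grid_nonneg[of n i i] grid_nonneg[of n i j]
    by (intro not_on_edge_if_coord_separated[where k = 1]) (auto simp del: position.simps)
  then show ?thesis using on by simp
qed

lemma vertex_on_high_edge:
  assumes ij: "i < j" "j < n" and w: "w \<in> vertices n"
    and on: "position n w \<in> edge_segment (position n) {Inl (j, j), Inl (i, j)}"
  shows "w \<in> {Inl (j, j), Inl (i, j)}"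
proof (cases w)
  case (Inl x)
  then obtain a b where ab: "w = Inl (a, b)" "a \<le> b" "b < n"
    using w by (auto simp: vertices_def)
  have "b = j"
  proof (rule ccontr)
    assume "b \<noteq> j"
    then have "b < j \<or> j < b" by auto
    then have "position n w \<notin> edge_segment (position n) {Inl (j, j), Inl (i, j)}"
      by (intro not_on_edge_if_coord_separated[where k = 2])
        (use ab ij in \<open>auto simp del: position.simps intro: grid_2_less\<close>)
    then show False using on by simp
  qed
  then show ?thesis
    using orient_high[of i j a n] orient_neq_0_imp_not_on_edge[of "position n" "Inl (j, j)" "Inl (i, j)" "position n w"]
      on ij ab by (cases "a = i"; cases "a = j") auto
next
  case (Inr a)
  then have "position n w $ 1 < 0"
    using w clique_neg by (auto simp: vertices_def simp del: position.simps)
  then have "position n w \<notin> edge_segment (position n) {Inl (j, j), Inl (i, j)}"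
    using grid_nonneg[of n i j] grid_nonneg[of n j j]
    by (intro not_on_edge_if_coord_separated[where k = 1]) (auto simp del: position.simps)
  then show ?thesis using on by simp
qed

lemma vertex_on_clique_edge:
  assumes "a < 5" "b < 5" "a \<noteq> b" and w: "w \<in> vertices n"
    and on: "position n w \<in> edge_segment (position n) {Inr a, Inr b}"
  shows "w \<in> {Inr a, Inr b}"
proof (cases w)
  case (Inl x)
  then have "0 \<le> position n w $ 1"
    using grid_nonneg[of n "fst x" "snd x"] by simp
  then have "position n w \<notin> edge_segment (position n) {Inr a, Inr b}"
    using clique_neg[of a n] clique_neg[of b n] assms(1,2)
    by (intro not_on_edge_if_coord_separated[where k = 1]) (auto simp del: position.simps)
  then show ?thesis using on by simp
next
  case (Inr c)
  then have "c < 5" using w by (auto simp: vertices_def)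
  then have "clique_orient a b c \<noteq> 0" if "c \<noteq> a" "c \<noteq> b"
    using clique_general_position[rule_format, of a b c] assms(1-3) that by simp
  then show ?thesis
    using orient_neq_0_imp_not_on_edge[of "position n" "Inr a" "Inr b" "position n w"] on Inr orient_clique[of n a b c]
    by auto
qed

lemma straight_line_drawing_position: "straight_line_drawing (vertices n) (edges n) (position n)"
  unfolding straight_line_drawing_def
proof (intro conjI ballI impI)
  show "inj_on (position n) (vertices n)" by (rule inj_on_position)
  fix e w assume e: "e \<in> edges n" and w: "w \<in> vertices n" and on: "position n w \<in> edge_segment (position n) e"
  consider i j where "e = {Inl (i, i), Inl (i, j)}" "i < j" "j < n"
    | i j where "e = {Inl (j, j), Inl (i, j)}" "i < j" "j < n"
    | a b where "e = {Inr a, Inr b}" "a < 5" "b < 5" "a \<noteq> b"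
    using e unfolding edges_def low_edges_def high_edges_def planar_clique_edges_def by fastforce
  then show "w \<in> e"
    using vertex_on_low_edge[OF _ _ w] vertex_on_high_edge[OF _ _ w] vertex_on_clique_edge[OF _ _ _ w] on
    by cases blast+
qed

section \<open>No crossings within a layer\<close>

lemma low_edges_noncrossing:
  assumes "e \<in> low_edges n" "f \<in> low_edges n" "e \<noteq> f"
  shows "\<not> edges_cross (position n) e f"
proof -
  obtain i j i' j' where e: "e = {Inl (i, i), Inl (i, j)}" "i < j" "j < n"
    and f: "f = {Inl (i', i'), Inl (i', j')}" "i' < j'" "j' < n"
    using assms by (auto simp: low_edges_def)
  have sep: "\<not> edges_cross (position n) {Inl (i, i), Inl (i, j)} {Inl (i', i'), Inl (i', j')}"
    if "i < j" "j < n" "i' < j'" "j' < n" "i < i'" for i j i' j'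
    by (rule not_edges_cross_if_coord_separated[where k = 1 and c = "real (n\<^sup>2 * i')"])
      (use that in \<open>auto simp del: position.simps of_nat_mult intro: grid_1_less(1)[where i' = i' and j' = j'] grid_strip(1)\<close>)
  show ?thesis
  proof (cases i i' rule: linorder_cases)
    case less then show ?thesis using sep e f by simp
  next
    case greater then show ?thesis using sep e f edges_cross_commute by metis
  next
    case equal
    then have "j \<noteq> j'" using e f assms(3) by auto
    then show ?thesis
      unfolding e(1) f(1) equal using e f equal by (intro not_edges_cross_if_star orient_low) auto
  qed
qed

lemma high_edges_noncrossing:
  assumes "e \<in> high_edges n" "f \<in> high_edges n" "e \<noteq> f"
  shows "\<not> edges_cross (position n) e f"
proof -
  obtain i j i' j' where e: "e = {Inl (j, j), Inl (i, j)}" "i < j" "j < n"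
    and f: "f = {Inl (j', j'), Inl (i', j')}" "i' < j'" "j' < n"
    using assms by (auto simp: high_edges_def)
  have sep: "\<not> edges_cross (position n) {Inl (j, j), Inl (i, j)} {Inl (j', j'), Inl (i', j')}"
    if "i < j" "j < n" "i' < j'" "j' < n" "j < j'" for i j i' j'
    by (rule not_edges_cross_if_coord_separated[where k = 2 and c = "real (n\<^sup>2 * j')"])
      (use that in \<open>auto simp del: position.simps of_nat_mult intro: grid_2_less(1)[where i' = i' and j' = j'] grid_strip(3)\<close>)
  show ?thesis
  proof (cases j j' rule: linorder_cases)
    case less then show ?thesis using sep e f by simp
  next
    case greater then show ?thesis using sep e f edges_cross_commute by metis
  next
    case equal
    then have "i \<noteq> i'" using e f assms(3) by auto
    then show ?thesis
      unfolding e(1) f(1) equal using e f equal by (intro not_edges_cross_if_star orient_high) auto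
  qed
qed

lemma planar_clique_edges_noncrossing:
  assumes "e \<in> planar_clique_edges" "f \<in> planar_clique_edges" "e \<noteq> f"
  shows "\<not> edges_cross (position n) e f"
proof -
  obtain a b c d where e: "e = {Inr a, Inr b}" "a < 5" "b < 5" "a \<noteq> b" "{a, b} \<noteq> {0, 4}"
    and f: "f = {Inr c, Inr d}" "c < 5" "d < 5" "c \<noteq> d" "{c, d} \<noteq> {0, 4}"
    using assms(1,2) unfolding planar_clique_edges_def by (elim CollectE exE conjE) (rule that)
  have star: "\<not> edges_cross (position n) {Inr u, Inr v} {Inr u, Inr w}"
    if "u < 5" "v < 5" "w < 5" "u \<noteq> v" "u \<noteq> w" "v \<noteq> w" for u v w
    using clique_general_position[rule_format, of u v w] that
    by (intro not_edges_cross_if_star) (simp add: orient_clique del: position.simps)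
  consider "a = c" | "a = d" | "b = c" | "b = d" | "a \<noteq> c" "a \<noteq> d" "b \<noteq> c" "b \<noteq> d"
    by blast
  then show ?thesis
  proof cases
    case 1 then show ?thesis using star[of a b d] e f assms(3) by auto
  next
    case 2 then show ?thesis using star[of a b c] e f assms(3) by (auto simp: insert_commute)
  next
    case 3 then show ?thesis using star[of b a d] e f assms(3) by (auto simp: insert_commute)
  next
    case 4 then show ?thesis using star[of b a c] e f assms(3) by (auto simp: insert_commute)
  next
    case 5
    have "clique_orient a b c * clique_orient a b d > 0 \<or> clique_orient c d a * clique_orient c d b > 0"
      using clique_noncrossing[rule_format, of a b c d] e f 5 by simp
    then have "orient (position n (Inr a)) (position n (Inr b)) (position n (Inr c)) *
          orient (position n (Inr a)) (position n (Inr b)) (position n (Inr d)) > 0 \<or>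
        orient (position n (Inr c)) (position n (Inr d)) (position n (Inr a)) *
          orient (position n (Inr c)) (position n (Inr d)) (position n (Inr b)) > 0"
      unfolding orient_clique by (simp flip: of_int_mult)
    then show ?thesis
      unfolding e(1) f(1) using not_edges_cross_if_one_side edges_cross_commute by metis
  qed
qed

lemma clique_grid_noncrossing:
  assumes "f \<subseteq> range Inl" "e \<subseteq> Inr ` {..<5}"
  shows "\<not> edges_cross (position n) e f"
proof (rule not_edges_cross_if_coord_separated[where k = 1 and c = 0])
  show "position n v $ 1 < 0" if "v \<in> e" for v
    using that assms(2) clique_neg by blast
  show "0 \<le> position n v $ 1" if "v \<in> f" for v
    using that assms(1) grid_nonneg by (metis imageE subsetD surj_pair)
qed

lemma noncrossing_layering_position:
  "noncrossing_layering (edges n) (position n) 2 (\<lambda>e. if e \<in> low_edges n \<union> planar_clique_edges then 0 else 1)"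
  unfolding noncrossing_layering_def
proof (intro conjI ballI impI; (elim conjE)?)
  fix e f
  assume ef: "e \<in> edges n" "f \<in> edges n" "e \<noteq> f"
    and same: "(if e \<in> low_edges n \<union> planar_clique_edges then 0 else 1) =
      (if f \<in> low_edges n \<union> planar_clique_edges then 0 else 1 :: nat)"
  \<comment> \<open>Common to both layers: a grid edge and a clique edge are separated by the
    vertical axis, so only pairs inside \<open>G\<close> or inside \<open>K\<close> remain. In the
    second layer \<open>K\<close> is a single edge.\<close>
  have layer: "\<not> edges_cross (position n) e f"
    if "e \<in> G \<union> K" "f \<in> G \<union> K" "\<And>g. g \<in> G \<Longrightarrow> g \<subseteq> range Inl" "\<And>g. g \<in> K \<Longrightarrow> g \<subseteq> Inr ` {..<5}"
      "e \<in> G \<Longrightarrow> f \<in> G \<Longrightarrow> \<not> edges_cross (position n) e f"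
      "e \<in> K \<Longrightarrow> f \<in> K \<Longrightarrow> \<not> edges_cross (position n) e f" for G K
    using that clique_grid_noncrossing[of f e n] clique_grid_noncrossing[of e f n]
      edges_cross_commute[of "position n" e f] by (elim UnE) simp_all
  show "\<not> edges_cross (position n) e f"
  proof (cases "e \<in> low_edges n \<union> planar_clique_edges")
    case True
    then have "f \<in> low_edges n \<union> planar_clique_edges"
      using same by presburger
    with True show ?thesis
      by (rule layer)
        (use ef low_edges_noncrossing planar_clique_edges_noncrossing in
          \<open>auto simp: low_edges_def planar_clique_edges_def\<close>)
  next
    case False
    then have "f \<notin> low_edges n \<union> planar_clique_edges"
      using same by presburger
    with False have "e \<in> high_edges n \<union> {{Inr 0, Inr 4}}" "f \<in> high_edges n \<union> {{Inr 0, Inr 4}}"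
      using ef unfolding edges_def by blast+
    then show ?thesis
      by (rule layer) (use ef high_edges_noncrossing in \<open>auto simp: high_edges_def\<close>)
  qed
qed auto

section \<open>Separating the two thicknesses\<close>

lemma finite_simple_graph_edges: "finite_simple_graph (vertices n) (edges n)"
proof -
  have "vertices n \<subseteq> Inl ` ({..<n} \<times> {..<n}) \<union> Inr ` {..<5}"
    by (auto simp: vertices_def)
  then have "finite (vertices n)"
    by (rule finite_subset) auto
  then show ?thesis
    by (auto simp: finite_simple_graph_def vertices_def edges_def low_edges_def high_edges_def
      planar_clique_edges_def)
qed

text \<open>Relabelling leaves the point set of every edge unchanged; this carries the drawing from
  the type \<open>vertex\<close> over to natural numbers.\<close>

lemma
  assumes "inj f"
  shows straight_line_drawing_image:
      "straight_line_drawing V E p \<Longrightarrow> straight_line_drawing (f ` V) ((`) f ` E) (p \<circ> inv f)"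
    and noncrossing_layering_image:
      "noncrossing_layering E p k l \<Longrightarrow> noncrossing_layering ((`) f ` E) (p \<circ> inv f) k (l \<circ> (`) (inv f))"
proof -
  have im: "(p \<circ> inv f) ` f ` e = p ` e" for e
    using assms by (simp add: image_comp o_assoc[symmetric])
  have seg: "edge_segment (p \<circ> inv f) (f ` e) = edge_segment p e" for e
    unfolding edge_segment_def im ..
  have cross: "edges_cross (p \<circ> inv f) (f ` e) (f ` e') = edges_cross p e e'" for e e'
    unfolding edges_cross_def seg image_Int[OF assms, symmetric] im ..
  show "straight_line_drawing V E p \<Longrightarrow> straight_line_drawing (f ` V) ((`) f ` E) (p \<circ> inv f)"
    using assms by (auto simp: straight_line_drawing_def seg inj_on_def)
  show "noncrossing_layering E p k l \<Longrightarrow> noncrossing_layering ((`) f ` E) (p \<circ> inv f) k (l \<circ> (`) (inv f))"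
    by (simp add: noncrossing_layering_def cross image_inv_f_f[OF assms] inj_image_eq_iff[OF assms])
qed

lemma five_clique_needs_two_layers:
  fixes q :: "nat \<Rightarrow> 'a"
  assumes "straight_line_drawing V E p" "noncrossing_layering E p k layer"
    and q: "inj_on q {..<5}" "q ` {..<5} \<subseteq> V"
    and E: "\<And>i j. i < 5 \<Longrightarrow> j < 5 \<Longrightarrow> i \<noteq> j \<Longrightarrow> {q i, q j} \<in> E"
  shows "2 \<le> k"
proof (rule ccontr)
  assume "\<not> 2 \<le> k"
  have "inj_on p (q ` {..<5})"
    using assms(1) q(2) unfolding straight_line_drawing_def by (blast intro: inj_on_subset)
  then have "inj_on (p \<circ> q) {..<5}"
    using q(1) by (rule comp_inj_on[rotated])
  from five_points_segments_meet[OF this] obtain a b c d where abcd: "{a, b, c, d} \<subseteq> {..<5}" "card {a, b, c, d} = 4"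
    "closed_segment (p (q a)) (p (q b)) \<inter> closed_segment (p (q c)) (p (q d)) \<noteq> {}"
    unfolding o_def by blast
  have "distinct [a, b, c, d]"
    using abcd(2) by (intro card_distinct) simp
  then have disj: "{q a, q b} \<inter> {q c, q d} = {}" "{q a, q b} \<in> E" "{q c, q d} \<in> E"
    using abcd(1) inj_on_eq_iff[OF q(1)] E by auto
  have "layer {q a, q b} < k" "layer {q c, q d} < k"
    using assms(2) disj(2,3) unfolding noncrossing_layering_def by simp_all
  then have "layer {q a, q b} = layer {q c, q d}"
    using \<open>\<not> 2 \<le> k\<close> by linarith
  moreover have "{q a, q b} \<noteq> {q c, q d}"
    using disj(1) by blast
  moreover have "edges_cross p {q a, q b} {q c, q d}"
    using abcd(3) disj(1) by (auto simp: edges_cross_def edge_segment_doubleton)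
  ultimately show False
    using assms(2) disj(2,3) unfolding noncrossing_layering_def by metis
qed

text \<open>Book thickness is a \<open>LEAST\<close>, unspecified unless some convex layered drawing exists.\<close>

lemma convex_drawing_exists:
  fixes V :: "nat set"
  assumes "finite_simple_graph V E"
  shows "\<exists>k p layer. straight_line_drawing V E p \<and> convex_position (p ` V) \<and> noncrossing_layering E p k layer"
proof -
  \<comment> \<open>Points on a parabola, with \<open>w i\<close> normal to the tangent at
    \<open>p i\<close>: the value \<open>w i \<bullet> p j\<close> exceeds the value at j = i by
    \<open>(j - i)^2\<close>, so the tangent strictly separates \<open>p i\<close> from all other
    points.\<close>
  define p :: "nat \<Rightarrow> real^2" where "p i = vector [real i, (real i)\<^sup>2]" for i
  define w :: "nat \<Rightarrow> real^2" where "w i = vector [- 2 * real i, 1]" for i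
  have w: "w i \<bullet> p j = (real j - real i)\<^sup>2 - (real i)\<^sup>2" for i j
    by (simp add: p_def w_def inner_vec_def sum_2 power2_eq_square algebra_simps)
  have not_hull: "p i \<notin> convex hull (p ` S)" if "i \<notin> S" for i S
  proof -
    have "convex hull (p ` S) \<subseteq> {x. w i \<bullet> x > - (real i)\<^sup>2}"
      using that by (intro hull_minimal convex_halfspace_gt) (auto simp: w)
    then show ?thesis
      by (auto simp: w)
  qed
  have inj: "inj p"
    by (auto simp: inj_def p_def real2_eq_iff)
  have fin: "finite V" "finite E"
    using assms finite_subset[of E "Pow V"] by (auto simp: finite_simple_graph_def)
  then obtain layer where layer: "bij_betw layer E {0..<card E}"
    using ex_bij_betw_finite_nat by blast
  have "straight_line_drawing V E p"
    using not_hull inj_on_subset[OF inj] by (auto simp: straight_line_drawing_def edge_segment_def)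
  moreover have "convex_position (p ` V)"
    unfolding convex_position_def
  proof
    fix x assume "x \<in> p ` V"
    then obtain i where i: "i \<in> V" "x = p i" by auto
    then have "p ` V = insert (p i) (p ` (V - {i}))" by auto
    then show "x extreme_point_of convex hull p ` V"
      using extreme_point_of_convex_hull_insert[of "p ` (V - {i})" "p i"] not_hull[of i "V - {i}"] fin i(2) by simp
  qed
  moreover have "noncrossing_layering E p (card E) layer"
    using layer by (auto simp: noncrossing_layering_def bij_betw_def inj_on_def)
  ultimately show ?thesis by blast
qed

theorem mainTheorem1:
  fixes t :: nat
  assumes "t > 0"
  shows "\<exists>(V :: nat set) (E :: nat set set).
    finite_simple_graph V E \<and> geometric_thickness V E = 2 \<and> book_thickness V E \<ge> t"
proof -
  obtain N where N: "\<And>s m A B. \<not> paged_subdivision N t s m A B"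
    using Ramsey_paged_subdivision by blast
  define f :: "vertex \<Rightarrow> nat" where "f = to_nat"
  have f: "inj f" by (simp add: f_def)
  define V E where "V = f ` vertices (Suc N)" and "E = (`) f ` edges (Suc N)"
  have graph: "finite_simple_graph V E"
    using finite_simple_graph_edges[of "Suc N"] f
    by (auto simp: finite_simple_graph_def V_def E_def card_image inj_on_subset[OF f])
  have drawing: "straight_line_drawing V E (position (Suc N) \<circ> inv f)"
    unfolding V_def E_def by (rule straight_line_drawing_image[OF f straight_line_drawing_position])
  have "\<exists>p layer. straight_line_drawing V E p \<and> noncrossing_layering E p 2 layer"
    using drawing noncrossing_layering_image[OF f noncrossing_layering_position[of "Suc N"]]
    unfolding E_def by blast
  moreover have "2 \<le> k" if "\<exists>p layer. straight_line_drawing V E p \<and> noncrossing_layering E p k layer" for k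
  proof -
    have "{f (Inr i), f (Inr j)} \<in> E" if "i < 5" "j < 5" "i \<noteq> j" for i j
    proof -
      have "{Inr i, Inr j} \<in> edges (Suc N)"
        using that by (auto simp: edges_def planar_clique_edges_def doubleton_eq_iff)
      then show ?thesis unfolding E_def by (intro image_eqI) auto
    qed
    moreover have "inj_on (\<lambda>i. f (Inr i)) {..<5}"
      using f by (auto simp: inj_on_def)
    moreover have "(\<lambda>i. f (Inr i)) ` {..<5} \<subseteq> V"
      by (auto simp: V_def vertices_def)
    ultimately show ?thesis
      using five_clique_needs_two_layers that by blast
  qed
  ultimately have "geometric_thickness V E = 2"
    unfolding geometric_thickness_def by (rule Least_equality)
  moreover have "t \<le> book_thickness V E"
  proof (rule ccontr)
    assume less: "\<not> t \<le> book_thickness V E"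
    obtain p layer where p: "straight_line_drawing V E p" "convex_position (p ` V)"
      "noncrossing_layering E p (book_thickness V E) layer"
      using LeastI_ex[OF convex_drawing_exists[OF graph]] unfolding book_thickness_def by blast
    \<comment> \<open>Layer numbers below the book thickness are also below t, so this is a layering
      with t layers, the number for which N was chosen.\<close>
    then have layering: "noncrossing_layering E p t layer"
      using less by (force simp: noncrossing_layering_def)
    \<comment> \<open>Subdivision vertices carry ordered index pairs; \<open>min\<close> and
      \<open>max\<close> give the symmetric form that renumbering along the spine requires.\<close>
    define mid where "mid i j = f (Inl (min i j, max i j))" for i j
    have midE: "{f (Inl (i, i)), mid i j} \<in> E" if "i < N" "j < N" "i \<noteq> j" for i j
    proof -
      have "{Inl (i, i), Inl (min i j, max i j)} \<in> edges (Suc N)"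
      proof (cases "i < j")
        case True
        then have "{Inl (i, i), Inl (i, j)} \<in> low_edges (Suc N)"
          using that unfolding low_edges_def by (intro CollectI exI conjI) auto
        with True show ?thesis by (simp add: edges_def min_def max_def)
      next
        case False
        have "{Inl (i, i), Inl (j, i)} \<in> high_edges (Suc N)"
          unfolding high_edges_def
          by (intro CollectI, rule exI[of _ j], rule exI[of _ i]) (use that False in auto)
        with False \<open>i \<noteq> j\<close> show ?thesis by (simp add: edges_def min_def max_def)
      qed
      then show ?thesis unfolding E_def mid_def by (intro image_eqI) auto
    qed
    have "\<exists>s m A B. paged_subdivision N t s m A B"
    proof (rule convex_subdivision_order[of V E p t layer N "\<lambda>i. f (Inl (i, i))" mid])
      show "finite V" using graph by (simp add: finite_simple_graph_def)
      show "straight_line_drawing V E p" "convex_position (p ` V)" "noncrossing_layering E p t layer"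
        using p layering by simp_all
      show "f (Inl (i, i)) \<in> V" if "i \<le> N" for i
        using that by (auto simp: V_def vertices_def)
      show "inj_on (\<lambda>i. f (Inl (i, i))) {..N}"
        using f by (auto simp: inj_on_def)
      show "mid i j \<in> V" if "i < N" "j < N" "i \<noteq> j" for i j
        using that by (auto simp: mid_def V_def vertices_def)
      show "mid i j = mid j i" for i j
        by (simp add: mid_def min.commute max.commute)
      show "{i, j} = {i', j'}" if "mid i j = mid i' j'" for i j i' j'
        using that f by (auto simp: mid_def inj_eq min_def max_def split: if_splits)
      show "mid i j \<noteq> f (Inl (l, l))" if "i \<noteq> j" for i j l
        using that f by (auto simp: mid_def inj_eq min_def max_def split: if_splits)
      show "{f (Inl (i, i)), mid i j} \<in> E" if "i < N" "j < N" "i \<noteq> j" for i j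
        using that by (rule midE)
    qed
    then show False
      using N by blast
  qed
  ultimately show ?thesis
    using graph by blast
qed

end
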